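(* Let $0<\varepsilon<1$ and $0<\sigma<2$. If $C>0$ is large enough, then with $b=C\log t$, as $t\to+\infty$, \[ U(t)=\frac{1}{2\pi i}\int_{-b-i\sigma}^{\,b-i\sigma}\Bigl(\frac{t}{2\pi}\Bigr)^{\frac{ix}{2}}\zeta\bigl(\tfrac12+i(t+x)\bigr)\,\frac{\pi}{2\sinh\frac{\pi x}{2}}\,dx+O\bigl(t^{-\frac56+\varepsilon}\bigr), \] the integral being over the horizontal segment from $-b-i\sigma$ to $b-i\sigma$. Moreover, if the Lindelöf hypothesis holds, the error term may be replaced by $O(t^{-1+\varepsilon})$.
   Context: $\vartheta$ is the Riemann–Siegel theta function: the holomorphic function on $\mathbb C\setminus(\{iy:y\ge\frac12\}\cup\{iy:y\le-\frac12\})$ with $\vartheta(0)=0$ and $e^{i\vartheta(t)}=\pi^{-it/2}\sqrt{\Gamma(\frac14+\frac{it}{2})/\Gamma(\frac14-\frac{it}{2})}$. $\zeta$ is the Riemann zeta function. For real $t$, \[ U(t)=\frac{1}{2\pi i}\int_{-i\sigma'-\infty}^{-i\sigma'+\infty} e^{i\vartheta(t+x)-i\vartheta(t)}\,\zeta\bigl(\tfrac12+i(t+x)\bigr)\,\frac{\pi}{2\sinh\frac{\pi x}{2}}\,dx,\qquad 0<\sigma'<\tfrac12, \] which is independent of $\sigma'\in(0,\frac12)$. Here $(t/2\pi)^{ix/2}=\exp(\frac{ix}{2}\log\frac{t}{2\pi})$. The Lindelöf hypothesis is the statement $\zeta(\frac12+it)=O(|t|^{\delta})$ for every $\delta>0$.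 *)

theory Defs
  imports "HOL-Complex_Analysis.Complex_Analysis" "HOL-Library.Landau_Symbols"
begin

text \<open>Riemann zeta function. For Re s > 1 the Dirichlet series; otherwise the
  standard continuation valid for Re s > 0, s \<noteq> 1:
  zeta s = s/(s-1) - s * int_1^infty frac(x) x^(-s-1) dx.
  (Only values with Re s > 0 are used below.)\<close>
definition zeta :: "complex \<Rightarrow> complex" where
  "zeta s = (if 1 < Re s then (\<Sum>n. 1 / of_nat (Suc n) powr s)
             else s / (s - 1) - s * integral {1..}
                    (\<lambda>x::real. of_real (frac x) * of_real x powr (- s - 1)))"

text \<open>Riemann--Siegel theta function, holomorphic on the plane slit along
  {iy : |y| \<ge> 1/2}, with theta 0 = 0, via the principal branch of log Gamma.\<close>
definition rs_theta :: "complex \<Rightarrow> complex" where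
  "rs_theta t = (ln_Gamma (1/4 + \<i> * t / 2) - ln_Gamma (1/4 - \<i> * t / 2)) / (2 * \<i>)
                 - t / 2 * of_real (ln pi)"

definition U_line :: "real \<Rightarrow> real \<Rightarrow> complex" where
  "U_line \<sigma>' t = 1 / (2 * pi * \<i>) * integral UNIV (\<lambda>u::real.
      let x = of_real u - \<i> * of_real \<sigma>' in
      exp (\<i> * rs_theta (of_real t + x) - \<i> * rs_theta (of_real t))
      * zeta (1/2 + \<i> * (of_real t + x)) * (of_real pi / (2 * sinh (of_real pi * x / 2))))"

text \<open>U is independent of sigma' in (0,1/2); we fix sigma' = 1/4.\<close>
definition U :: "real \<Rightarrow> complex" where
  "U t = U_line (1/4) t"

definition trunc_integral :: "real \<Rightarrow> real \<Rightarrow> real \<Rightarrow> complex" where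
  "trunc_integral b \<sigma> t = 1 / (2 * pi * \<i>) *
     contour_integral (linepath (- of_real b - \<i> * of_real \<sigma>) (of_real b - \<i> * of_real \<sigma>))
       (\<lambda>x. exp (\<i> * x / 2 * of_real (ln (t / (2 * pi))))
            * zeta (1/2 + \<i> * (of_real t + x)) * (of_real pi / (2 * sinh (of_real pi * x / 2))))"

definition lindelof_hypothesis :: bool where
  "lindelof_hypothesis \<longleftrightarrow> (\<forall>\<delta>>0.
     (\<lambda>t::real. zeta (1/2 + \<i> * of_real t)) \<in> O[at_infinity](\<lambda>t. of_real (\<bar>t\<bar> powr \<delta>)))"

end

theory Submission
  imports Defs "HOL-Real_Asymp.Real_Asymp"
begin

text \<open>
  Truncating the integral for U at |Re x| = C log t and moving the line of the truncated integral to
  Im x = -1/4 costs only negative powers of t, because the kernel decays exponentially. The difference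
  of the two integrands carries the factor exp(i theta(t+x) - i theta(t)) - (t/2pi)^(ix/2), which
  vanishes at x = 0 and so cancels the pole of the kernel; hence the difference may be integrated along
  the real line itself. There Stirling's formula, in the form theta'(t) = (1/2) log(t/2pi) + O(1/t),
  shows that it is O(|x| (1 + |x|) / t), so the error is (log t)^2 / t times the size of zeta on the
  critical line near height t. Both error terms follow from bounds for zeta(1/2 + it): the Lindeloef
  hypothesis, or Weyl's bound O(t^(1/6) log t). The latter comes from dyadic sums of n^(-it), estimated
  by the Kusmin-Landau inequality, by the second derivative test derived from it, and by one van der
  Corput differencing step followed by the second derivative test.
\<close>

section \<open>Exponential sums\<close>

text \<open>The theta factor is holomorphic only for |Im x| < 1/2, while the truncated integral may
  lie at any depth below 2; hence the truncated integral is the one that moves, to the line on which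
  \<open>U\<close> is defined. Below the real axis the argument of zeta only moves to the right, so
  no information left of the critical line enters. Neither integrand can reach the real axis alone,
  because the kernel has its pole there. On the real axis both exponential factors have modulus 1,
  so comparing them is comparing two real phases, and zeta is evaluated on the critical line itself.
  All vertical sides and tails are estimated crudely, with zeta = O(t); they are O(t^2 exp(-b)), and
  C >= 4 turns this into O(t^(-2)). In the exponential sums t is written as q^6: the critical
  lengths t^(1/3), t^(2/3), t become q^2, q^4, q^6, and the target for a block of length M is
  sqrt(M) * q throughout.\<close>

lemma sin_pi_ge:
  assumes "0 \<le> r" "r \<le> (1/2::real)"
  shows "r \<le> sin (pi * r)"
proof -
  have "concave_on {0..pi} sin"
    unfolding concave_on_def
  proof (rule f''_ge0_imp_convex[where f' = "\<lambda>x. - cos x" and f'' = sin])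
    fix x :: real assume "x \<in> {0..pi}"
    show "((\<lambda>x. - sin x) has_real_derivative - cos x) (at x)"
      by (auto intro!: derivative_eq_intros)
    show "((\<lambda>x. - cos x) has_real_derivative sin x) (at x)"
      by (auto intro!: derivative_eq_intros)
    show "0 \<le> sin x" using \<open>x \<in> {0..pi}\<close> by (simp add: sin_ge_zero)
  qed auto
  then have "(1 - 2 * r) * sin 0 + (2 * r) * sin (pi / 2) \<le> sin ((1 - 2 * r) *\<^sub>R 0 + (2 * r) *\<^sub>R (pi/2))"
    using assms unfolding concave_on_iff
    by (elim conjE, drule_tac bspec[of _ _ 0], simp, drule_tac bspec[of _ _ "pi/2"], simp)
       (drule spec[of _ "1 - 2 * r"], simp)
  then show ?thesis using assms by (simp add: mult.commute)
qed

lemma sin_pi_ge_both: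
  assumes "r \<le> d" "d \<le> 1 - r" "0 < r"
  shows "r \<le> sin (pi * (d::real))"
proof (cases "d \<le> 1/2")
  case True
  then show ?thesis using sin_pi_ge[of d] assms by simp
next
  case False
  have "sin (pi * d) = sin (pi * (1 - d))"
    by (simp add: algebra_simps sin_diff)
  then show ?thesis using sin_pi_ge[of "1 - d"] assms False by simp
qed

text \<open>This is the coefficient in the telescoping formula behind Kusmin-Landau. Its real part
  is constant, so only the cotangent varies, and a monotone cotangent has total variation determined
  by its end values.\<close>

lemma inverse_one_minus_cis:
  assumes "sin (pi * d) \<noteq> 0"
  shows "1 / (1 - cis (2 * pi * d)) = 1/2 + \<i> / 2 * of_real (cot (pi * d))"
proof -
  have *: "cis (2 * pi * d) = Complex (1 - 2 * (sin (pi * d))\<^sup>2) (2 * sin (pi * d) * cos (pi * d))"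
    using cos_double_sin[of "pi * d"] sin_double[of "pi * d"]
    by (simp add: complex_eq_iff mult_ac)
  have "1 - cis (2 * pi * d) \<noteq> 0"
    using assms unfolding * by (simp add: complex_eq_iff)
  moreover have "(1/2 + \<i> / 2 * of_real (cot (pi * d))) * (1 - cis (2 * pi * d)) = 1"
  proof -
    have c: "sin (pi * d) = cos (pi * d) * (cos (pi * d) * sin (pi * d)) + sin (pi * d) * (sin (pi * d) * sin (pi * d))"
      using sin_cos_squared_add[of "pi * d"] by algebra
    show ?thesis
      using assms unfolding *
      by (simp add: complex_eq_iff cot_def field_simps power2_eq_square)
         (use c in linarith)
  qed
  ultimately show ?thesis by (metis nonzero_eq_divide_eq)
qed

lemma cot_antimono:
  assumes "0 < x" "x \<le> y" "y < pi"
  shows "cot y \<le> cot (x::real)"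
proof -
  have s: "sin x > 0" "sin y > 0" using assms by (auto intro: sin_gt_zero)
  have "sin (y - x) \<ge> 0" using assms by (intro sin_ge_zero) auto
  then show ?thesis using s by (simp add: cot_def field_simps sin_diff)
qed

text \<open>Each term satisfies \<open>e n = c n * (e n - e (Suc n))\<close> with
  \<open>c n = 1 / (1 - cis (2 * pi * d n))\<close>. Summation by parts moves the difference onto
  \<open>c\<close>; since \<open>d\<close> is monotone, the variation of the cotangents telescopes
  instead of accumulating with the number of terms.\<close>

lemma kusmin_landau_unit:
  fixes f :: "nat \<Rightarrow> real"
  defines "d \<equiv> \<lambda>n. f (Suc n) - f n"
  assumes mono: "\<And>n. a \<le> n \<Longrightarrow> Suc n < b \<Longrightarrow> d n \<le> d (Suc n)"
    and rng: "\<And>n. a \<le> n \<Longrightarrow> n < b \<Longrightarrow> r \<le> d n \<and> d n \<le> 1 - r"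
    and r: "0 < r"
  shows "norm (\<Sum>n=a..<b. cis (2 * pi * f n)) \<le> 3 / r"
proof (cases "a < b")
  case False then show ?thesis using r by simp
next
  case True
  define c where "c = (\<lambda>n. 1/2 + \<i> / 2 * complex_of_real (cot (pi * d n)))"
  define e where "e = (\<lambda>n. cis (2 * pi * f n))"
  have spos: "r \<le> sin (pi * d n)" if "a \<le> n" "n < b" for n
    using sin_pi_ge_both rng[OF that] r by blast
  have ne: "1 - cis (2 * pi * d n) \<noteq> 0" and ceq: "c n = 1 / (1 - cis (2 * pi * d n))"
    if "a \<le> n" "n < b" for n
  proof -
    have "sin (pi * d n) \<noteq> 0" using spos[OF that] r by simp
    then show "c n = 1 / (1 - cis (2 * pi * d n))"
      using inverse_one_minus_cis[of "d n"] by (simp add: c_def)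
    show "1 - cis (2 * pi * d n) \<noteq> 0"
    proof
      assume "1 - cis (2 * pi * d n) = 0"
      then have "Re (cis (2 * pi * d n)) = 1" by (simp add: complex_eq_iff)
      then have "cos (2 * (pi * d n)) = 1" by (simp add: mult_ac)
      with \<open>sin (pi * d n) \<noteq> 0\<close> show False
        by (simp only: cos_double_sin) simp
    qed
  qed
  have step: "e n = c n * (e n - e (Suc n))" if "a \<le> n" "n < b" for n
  proof -
    have "e (Suc n) = e n * cis (2 * pi * d n)"
      unfolding e_def d_def by (simp add: cis_mult algebra_simps)
    then have "e n - e (Suc n) = e n * (1 - cis (2 * pi * d n))" by (simp add: algebra_simps)
    then show ?thesis using ne[OF that] ceq[OF that] by simp
  qed
  have normc: "norm (c n) \<le> 1 / r" and cotb: "\<bar>cot (pi * d n)\<bar> \<le> 1 / r"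
    if "a \<le> n" "n < b" for n
  proof -
    have s: "r \<le> sin (pi * d n)" by (rule spos[OF that])
    have "\<bar>cot (pi * d n)\<bar> = \<bar>cos (pi * d n)\<bar> / sin (pi * d n)"
      using s r by (simp add: cot_def abs_divide)
    also have "\<dots> \<le> 1 / r"
      using s r by (intro frac_le) auto
    finally show 1: "\<bar>cot (pi * d n)\<bar> \<le> 1 / r" .
    \<comment> \<open>An index in the range exists here, so r <= 1 - r; this lets
      \<open>1 / r\<close> absorb the constant real part 1/2 of \<open>c n\<close>.\<close>
    have "r \<le> 1/2" using rng[OF that] by linarith
    then have "1 \<le> 1 / r" using r by simp
    have "norm (c n) \<le> 1/2 + \<bar>cot (pi * d n)\<bar> / 2"
      unfolding c_def by (rule order_trans[OF norm_triangle_ineq]) (simp add: norm_mult norm_divide)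
    then show "norm (c n) \<le> 1 / r" using 1 \<open>1 \<le> 1 / r\<close> by linarith
  qed
  \<comment> \<open>Keeping the boundary term \<open>c m * e (Suc m)\<close> inside the norm is what
    closes the induction: a step then adds only
    \<open>(c (Suc m) - c m) * e (Suc m)\<close>.\<close>
  have main: "norm ((\<Sum>n=a..<Suc m. e n) + c m * e (Suc m))
      \<le> norm (c a) + (cot (pi * d a) - cot (pi * d m)) / 2" if "a \<le> m" "m < b" for m
    using that
  proof (induction m rule: dec_induct)
    case base
    have "e a + c a * e (Suc a) = c a * e a" using step[of a] True by (simp add: algebra_simps)
    then show ?case by (simp add: norm_mult e_def)
  next
    case (step m)
    have IH: "norm ((\<Sum>n=a..<Suc m. e n) + c m * e (Suc m))
      \<le> norm (c a) + (cot (pi * d a) - cot (pi * d m)) / 2" using step by simp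
    have eq: "e (Suc m) + c (Suc m) * e (Suc (Suc m)) = c (Suc m) * e (Suc m)"
      using \<open>\<And>n. a \<le> n \<Longrightarrow> n < b \<Longrightarrow> e n = c n * (e n - e (Suc n))\<close>[of "Suc m"] step.hyps step.prems
      by (simp add: algebra_simps)
    have "(\<Sum>n=a..<Suc (Suc m). e n) + c (Suc m) * e (Suc (Suc m))
       = (\<Sum>n=a..<Suc m. e n) + (e (Suc m) + c (Suc m) * e (Suc (Suc m)))"
      using step.hyps by simp
    also have "\<dots> = ((\<Sum>n=a..<Suc m. e n) + c m * e (Suc m)) + (c (Suc m) - c m) * e (Suc m)"
      unfolding eq by (simp add: algebra_simps)
    finally have *: "norm ((\<Sum>n=a..<Suc (Suc m). e n) + c (Suc m) * e (Suc (Suc m)))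
       \<le> norm ((\<Sum>n=a..<Suc m. e n) + c m * e (Suc m)) + norm ((c (Suc m) - c m) * e (Suc m))"
      by (metis norm_triangle_ineq)
    have "cot (pi * d (Suc m)) \<le> cot (pi * d m)"
      using rng[of m] rng[of "Suc m"] mono[of m] r step.hyps step.prems
      by (intro cot_antimono) auto
    moreover have "norm ((c (Suc m) - c m) * e (Suc m)) = \<bar>cot (pi * d (Suc m)) - cot (pi * d m)\<bar> / 2"
    proof -
      have "c (Suc m) - c m = \<i> / 2 * of_real (cot (pi * d (Suc m)) - cot (pi * d m))"
        by (simp add: c_def algebra_simps)
      then show ?thesis by (simp only: norm_mult norm_divide) (simp add: e_def del: of_real_diff)
    qed
    ultimately show ?case using * IH by (simp add: field_simps)
  qed
  define m where "m = b - 1"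
  have m: "a \<le> m" "m < b" "Suc m = b" using True by (auto simp: m_def)
  have "norm (\<Sum>n=a..<b. e n) \<le> norm ((\<Sum>n=a..<Suc m. e n) + c m * e (Suc m)) + norm (c m * e (Suc m))"
    using norm_triangle_ineq4[of "(\<Sum>n=a..<Suc m. e n) + c m * e (Suc m)" "c m * e (Suc m)"] m(3)
    by simp
  \<comment> \<open>First coefficient, half the variation of the cotangent, and the boundary term:
    each costs at most \<open>1 / r\<close>.\<close>
  also have "\<dots> \<le> (1 / r + (1 / r + 1 / r) / 2) + 1 / r"
  proof (rule add_mono)
    show "norm ((\<Sum>n=a..<Suc m. e n) + c m * e (Suc m)) \<le> 1 / r + (1 / r + 1 / r) / 2"
    proof -
      have "(cot (pi * d a) - cot (pi * d m)) / 2 \<le> (1 / r + 1 / r) / 2"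
        using cotb[OF order_refl True] cotb[OF m(1,2)] unfolding abs_le_iff
        by (intro divide_right_mono) linarith+
      then show ?thesis using main[OF m(1,2)] normc[OF order_refl True] by linarith
    qed
    show "norm (c m * e (Suc m)) \<le> 1 / r"
      using normc[of m] m by (simp add: norm_mult e_def)
  qed
  finally show ?thesis unfolding e_def by simp
qed

text \<open>Only the phase modulo 1 matters, so subtracting \<open>k * n\<close> moves the
  increments into [r, 1 - r].\<close>

theorem kusmin_landau:
  fixes f :: "nat \<Rightarrow> real" and k :: int and r :: real
  assumes mono: "\<And>n. a \<le> n \<Longrightarrow> Suc n < b \<Longrightarrow> f (Suc n) - f n \<le> f (Suc (Suc n)) - f (Suc n)"
    and rng: "\<And>n. a \<le> n \<Longrightarrow> n < b \<Longrightarrow> of_int k + r \<le> f (Suc n) - f n \<and> f (Suc n) - f n \<le> of_int k + 1 - r"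
    and r: "0 < r"
  shows "norm (\<Sum>n=a..<b. cis (2 * pi * f n)) \<le> 3 / r"
proof -
  define g where "g = (\<lambda>n. f n - k * real n)"
  have "cis (2 * pi * f n) = cis (2 * pi * g n)" for n
  proof -
    have "cis (2 * pi * f n) = cis (2 * pi * g n) * cis (2 * pi * of_int (k * int n))"
      unfolding g_def cis_mult by (simp add: algebra_simps)
    then show ?thesis by (simp add: cis_multiple_2pi)
  qed
  moreover have "norm (\<Sum>n=a..<b. cis (2 * pi * g n)) \<le> 3 / r"
  proof (rule kusmin_landau_unit)
    fix n assume n: "a \<le> n" "Suc n < b"
    show "g (Suc n) - g n \<le> g (Suc (Suc n)) - g (Suc n)"
      using mono[OF n] by (simp add: g_def algebra_simps)
  next
    fix n assume n: "a \<le> n" "n < b"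
    show "r \<le> g (Suc n) - g n \<and> g (Suc n) - g n \<le> 1 - r"
      using rng[OF n] by (simp add: g_def algebra_simps)
  qed (rule r)
  ultimately show ?thesis by simp
qed

section \<open>The second derivative test\<close>

lemma convex_nat_set_eq_interval:
  fixes A :: "nat set"
  assumes "finite A" and conv: "\<And>i j k. i \<in> A \<Longrightarrow> k \<in> A \<Longrightarrow> i \<le> j \<Longrightarrow> j \<le> k \<Longrightarrow> j \<in> A"
  obtains a b where "A = {a..<b}"
proof (cases "A = {}")
  case True then show ?thesis using that[of 0 0] by simp
next
  case False
  have "A = {Min A..<Suc (Max A)}"
  proof
    show "A \<subseteq> {Min A..<Suc (Max A)}"
      using assms(1) by (auto simp: less_Suc_eq_le)
    show "{Min A..<Suc (Max A)} \<subseteq> A"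
      using conv[OF Min_in[OF assms(1) False] Max_in[OF assms(1) False]] by (auto simp: less_Suc_eq_le)
  qed
  then show ?thesis by (rule that)
qed

text \<open>Used to count the indices whose increment is close to an integer, where Kusmin-Landau
  fails: growth at rate at least \<open>l\<close> forbids a long stay in a short window.\<close>

lemma card_slow_range_le:
  fixes d :: "nat \<Rightarrow> real"
  assumes gap: "\<And>i j. i \<in> A \<Longrightarrow> j \<in> A \<Longrightarrow> i \<le> j \<Longrightarrow> l * (real j - real i) \<le> d j - d i"
    and fin: "finite A" and rng: "\<And>n. n \<in> A \<Longrightarrow> x \<le> d n \<and> d n \<le> y" and l: "l > 0" and xy: "x \<le> y"
  shows "real (card A) \<le> (y - x) / l + 1"
proof (cases "A = {}")
  case True then show ?thesis using xy l by simp
next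
  case False
  let ?i = "Min A" and ?j = "Max A"
  have ij: "?i \<in> A" "?j \<in> A" "?i \<le> ?j" using fin False by auto
  have "A \<subseteq> {?i..?j}" using fin by auto
  then have "card A \<le> card {?i..?j}" by (intro card_mono) auto
  then have "real (card A) \<le> real ?j - real ?i + 1" using ij(3) by simp
  moreover have "l * (real ?j - real ?i) \<le> y - x"
    using gap[OF ij] rng[OF ij(1)] rng[OF ij(2)] by linarith
  then have "real ?j - real ?i \<le> (y - x) / l" using l by (simp add: field_simps)
  ultimately show ?thesis by linarith
qed

lemma norm_sum_cis_le_card: "norm (\<Sum>n\<in>A. cis (g n)) \<le> real (card A)"
  by (rule order_trans[OF norm_sum]) simp

text \<open>Group the indices by the integer part of the increment \<open>d n\<close>; there are at
  most \<open>L * N + 2\<close> groups. In a group, the increments within \<open>r\<close> of an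
  integer are counted trivially, at most r/l + 1 at each end, and the rest form an interval to which
  Kusmin-Landau gives 3/r.\<close>

theorem second_difference_test:
  fixes f :: "nat \<Rightarrow> real"
  defines "d \<equiv> \<lambda>n. f (Suc n) - f n"
  assumes diff: "\<And>n. a \<le> n \<Longrightarrow> Suc n < b \<Longrightarrow> l \<le> d (Suc n) - d n \<and> d (Suc n) - d n \<le> L"
    and l: "0 < l" "l \<le> 1" and L: "0 \<le> L" and N: "real (b - a) \<le> N"
  shows "norm (\<Sum>n=a..<b. cis (2 * pi * f n)) \<le> 9 * (L * N + 2) / sqrt l"
proof (cases "a < b")
  case False
  then show ?thesis using l L N by auto
next
  case True
  have gap: "l * (real j - real i) \<le> d j - d i \<and> d j - d i \<le> L * (real j - real i)"
    if "a \<le> i" "i \<le> j" "j < b" for i j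
    using that(2,3)
  proof (induction j rule: dec_induct)
    case (step j)
    then show ?case using diff[of j] that(1) by (simp add: algebra_simps)
  qed simp
  have mono: "d i \<le> d j" if "a \<le> i" "i \<le> j" "j < b" for i j
  proof -
    have "0 \<le> l * (real j - real i)" using that l by simp
    then show ?thesis using gap[OF that] by linarith
  qed
  \<comment> \<open>Balances the count r/l against 3/r up to constants; the factor 1/2 ensures r <=
    1/2, so that the two end windows are disjoint.\<close>
  define r where "r = sqrt l / 2"
  have r: "0 < r" "r \<le> 1/2" using l by (auto simp: r_def)
  have fiber: "norm (\<Sum>n\<in>{n \<in> {a..<b}. \<lfloor>d n\<rfloor> = k}. cis (2 * pi * f n)) \<le> 9 / sqrt l" for k :: int
  proof -
    define F where "F = {n \<in> {a..<b}. \<lfloor>d n\<rfloor> = k}"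
    define A where "A = {n \<in> {a..<b}. k \<le> d n \<and> d n < k + r}"
    define B where "B = {n \<in> {a..<b}. k + r \<le> d n \<and> d n \<le> k + 1 - r}"
    define D where "D = {n \<in> {a..<b}. k + 1 - r < d n \<and> d n < k + 1}"
    have F: "F = A \<union> (B \<union> D)"
      using r unfolding F_def A_def B_def D_def by (auto simp: floor_eq_iff)
    have disj: "A \<inter> (B \<union> D) = {}" "B \<inter> D = {}"
      using r unfolding A_def B_def D_def by auto
    have fin: "finite A" "finite B" "finite D" unfolding A_def B_def D_def by auto
    have "real (card A) \<le> ((k + r) - k) / l + 1"
      by (rule card_slow_range_le[of A l d]) (use gap fin r l in \<open>auto simp: A_def\<close>)
    then have cA: "real (card A) \<le> r / l + 1" by simp
    have "real (card D) \<le> ((k + 1) - (k + 1 - r)) / l + 1"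
      by (rule card_slow_range_le[of D l d]) (use gap fin r l in \<open>auto simp: D_def\<close>)
    then have cD: "real (card D) \<le> r / l + 1" by simp
    have Bb: "norm (\<Sum>n\<in>B. cis (2 * pi * f n)) \<le> 3 / r"
    proof -
      have "j \<in> B" if "i \<in> B" "m \<in> B" "i \<le> j" "j \<le> m" for i j m
        using that mono[of i j] mono[of j m] unfolding B_def by auto
      then obtain a' b' where B: "B = {a'..<b'}"
        using convex_nat_set_eq_interval[OF fin(2)] by blast
      have sub: "a \<le> n \<and> n < b \<and> k + r \<le> d n \<and> d n \<le> k + 1 - r" if "a' \<le> n" "n < b'" for n
      proof -
        have "n \<in> B" using that B by simp
        then show ?thesis unfolding B_def by simp
      qed
      show ?thesis unfolding B
      proof (rule kusmin_landau[where k = k])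
        fix n assume n: "a' \<le> n" "Suc n < b'"
        show "f (Suc n) - f n \<le> f (Suc (Suc n)) - f (Suc n)"
          using mono[of n "Suc n"] sub[of n] sub[of "Suc n"] n by (simp add: d_def)
      next
        fix n assume n: "a' \<le> n" "n < b'"
        show "real_of_int k + r \<le> f (Suc n) - f n \<and> f (Suc n) - f n \<le> real_of_int k + 1 - r"
          using sub[OF n] by (simp add: d_def)
      qed (rule r)
    qed
    have "norm (\<Sum>n\<in>F. cis (2 * pi * f n)) \<le> norm (\<Sum>n\<in>A. cis (2 * pi * f n))
        + (norm (\<Sum>n\<in>B. cis (2 * pi * f n)) + norm (\<Sum>n\<in>D. cis (2 * pi * f n)))"
    proof -
      have "(\<Sum>n\<in>F. cis (2 * pi * f n)) = (\<Sum>n\<in>A. cis (2 * pi * f n))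
          + ((\<Sum>n\<in>B. cis (2 * pi * f n)) + (\<Sum>n\<in>D. cis (2 * pi * f n)))"
        unfolding F using fin disj by (simp add: sum.union_disjoint)
      then show ?thesis
        using norm_triangle_ineq[of "\<Sum>n\<in>A. cis (2 * pi * f n)" "(\<Sum>n\<in>B. cis (2 * pi * f n)) + (\<Sum>n\<in>D. cis (2 * pi * f n))"]
          norm_triangle_ineq[of "\<Sum>n\<in>B. cis (2 * pi * f n)" "\<Sum>n\<in>D. cis (2 * pi * f n)"]
        by simp
    qed
    also have "\<dots> \<le> (r / l + 1) + (3 / r + (r / l + 1))"
      using cA cD Bb norm_sum_cis_le_card[of "\<lambda>n. 2 * pi * f n" A]
        norm_sum_cis_le_card[of "\<lambda>n. 2 * pi * f n" D] by linarith
    also have "\<dots> = 7 / sqrt l + 2"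
      using l real_sqrt_pow2[of l] by (simp add: r_def field_simps power2_eq_square)
    also have "\<dots> \<le> 9 / sqrt l"
      using l by (simp add: field_simps)
    finally show ?thesis unfolding F_def .
  qed
  \<comment> \<open>The integer parts that occur; as \<open>d\<close> is monotone they lie between
    those of its first and last value.\<close>
  define T where "T = (\<lambda>n. \<lfloor>d n\<rfloor>) ` {a..<b}"
  have "T \<subseteq> {\<lfloor>d a\<rfloor>..\<lfloor>d (b - 1)\<rfloor>}"
    unfolding T_def using True by (auto intro!: floor_mono mono)
  then have "card T \<le> card {\<lfloor>d a\<rfloor>..\<lfloor>d (b - 1)\<rfloor>}" by (intro card_mono) auto
  also have "\<dots> = nat (\<lfloor>d (b - 1)\<rfloor> - \<lfloor>d a\<rfloor> + 1)" by simp
  finally have "real (card T) \<le> real_of_int (\<lfloor>d (b - 1)\<rfloor> - \<lfloor>d a\<rfloor> + 1)"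
    using floor_mono[OF mono[of a "b - 1"]] True by linarith
  also have "\<dots> \<le> d (b - 1) - d a + 2" by linarith
  also have "d (b - 1) - d a \<le> L * (real (b - 1) - real a)" using gap[of a "b - 1"] True by auto
  also have "\<dots> \<le> L * N" using L N True by (intro mult_left_mono) auto
  finally have cT: "real (card T) \<le> L * N + 2" by simp
  have "(\<Sum>n=a..<b. cis (2 * pi * f n)) = (\<Sum>k\<in>T. \<Sum>n\<in>{n \<in> {a..<b}. \<lfloor>d n\<rfloor> = k}. cis (2 * pi * f n))"
    unfolding T_def by (rule sum.image_gen) simp
  also have "norm \<dots> \<le> real (card T) * (9 / sqrt l)"
    by (rule order_trans[OF norm_sum]) (use sum_bounded_above[of T, OF fiber] in simp)
  also have "\<dots> \<le> (L * N + 2) * (9 / sqrt l)"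
    using cT l by (intro mult_right_mono) auto
  finally show ?thesis by (simp add: mult_ac)
qed

section \<open>Van der Corput differencing\<close>

lemma sum_shift_nat: "(\<Sum>m=a+k..<b+k. g (m - k)) = (\<Sum>n=a..<b. g (n::nat))"
  by (rule sum.reindex_bij_witness[of _ "\<lambda>n. n + k" "\<lambda>m. m - k"]) auto

text \<open>Averaging over H shifts of \<open>z\<close> writes H times the sum as one sum over
  \<open>b - a + H\<close> positions. Cauchy-Schwarz over the positions and expansion of the square
  leave only the correlations \<open>C h\<close>. For the summands considered later, a correlation
  has a phase of smaller second derivative.\<close>

theorem van_der_corput_inequality:
  fixes z :: "nat \<Rightarrow> complex" and a b :: nat
  defines "C \<equiv> \<lambda>h. \<Sum>n=a..<b-h. z (n + h) * cnj (z n)"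
  assumes H: "0 < H" and ab: "a \<le> b"
  shows "real H * (norm (\<Sum>n=a..<b. z n))\<^sup>2
     \<le> real (b - a + H) * (norm (C 0) + 2 * (\<Sum>h=1..<H. norm (C h)))"
proof -
  \<comment> \<open>\<open>w k\<close> is \<open>z\<close> moved right by \<open>k\<close> and
    extended by zero; for k < H every support lies in \<open>M\<close>.\<close>
  define w where "w = (\<lambda>k m. if m \<in> {a+k..<b+k} then z (m - k) else 0)"
  define M where "M = {a..<b+H}"
  define S where "S = (\<Sum>n=a..<b. z n)"
  have sumw: "(\<Sum>m\<in>M. w k m) = S" if "k < H" for k
  proof -
    have "(\<Sum>m\<in>M. w k m) = (\<Sum>m=a+k..<b+k. z (m - k))"
      unfolding w_def M_def by (subst sum.inter_restrict[symmetric]) (use that in \<open>auto intro!: sum.cong\<close>)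
    then show ?thesis unfolding S_def by (simp only: sum_shift_nat)
  qed
  have corr: "(\<Sum>m\<in>M. w k m * cnj (w l m)) = C (l - k)" if "k \<le> l" "l < H" for k l
  proof -
    have "(\<Sum>m\<in>M. w k m * cnj (w l m)) = (\<Sum>m\<in>M. if m \<in> {a+l..<b+k} then z (m - k) * cnj (z (m - l)) else 0)"
      unfolding w_def using that by (intro sum.cong) auto
    also have "\<dots> = (\<Sum>m=a+l..<b+k. z (m - k) * cnj (z (m - l)))"
      unfolding M_def by (subst sum.inter_restrict[symmetric]) (use that in \<open>auto intro!: sum.cong\<close>)
    also have "\<dots> = C (l - k)"
      unfolding C_def
      by (rule sum.reindex_bij_witness[of _ "\<lambda>n. n + l" "\<lambda>m. m - l"]) (use that in auto)
    finally show ?thesis .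
  qed
  have corr': "norm (\<Sum>m\<in>M. w k m * cnj (w l m)) = norm (C (if k \<le> l then l - k else k - l))"
    if "k < H" "l < H" for k l
  proof (cases "k \<le> l")
    case True then show ?thesis using corr that by simp
  next
    case False
    have "(\<Sum>m\<in>M. w k m * cnj (w l m)) = cnj (\<Sum>m\<in>M. w l m * cnj (w k m))"
      by (simp add: mult.commute)
    then show ?thesis using corr[of l k] that False by simp
  qed
  \<comment> \<open>In a row of the H by H array of correlations the difference 0 occurs once and
    every h >= 1 at most twice, on either side of the diagonal.\<close>
  have row: "(\<Sum>l<H. norm (C (if k \<le> l then l - k else k - l))) \<le> norm (C 0) + 2 * (\<Sum>h=1..<H. norm (C h))"
    if "k < H" for k
  proof -
    have split: "{..<H} = {..<k} \<union> ({k} \<union> {Suc k..<H})" using that by auto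
    have 1: "(\<Sum>l<k. norm (C (k - l))) \<le> (\<Sum>h=1..<H. norm (C h))"
    proof -
      have "(\<Sum>l<k. norm (C (k - l))) = (\<Sum>h\<in>(\<lambda>l. k - l) ` {..<k}. norm (C h))"
        by (subst sum.reindex) (auto simp: inj_on_def)
      also have "\<dots> \<le> (\<Sum>h=1..<H. norm (C h))"
        by (rule sum_mono2) (use that in auto)
      finally show ?thesis .
    qed
    have 2: "(\<Sum>l=Suc k..<H. norm (C (l - k))) \<le> (\<Sum>h=1..<H. norm (C h))"
    proof -
      have "(\<Sum>l=Suc k..<H. norm (C (l - k))) = (\<Sum>h\<in>(\<lambda>l. l - k) ` {Suc k..<H}. norm (C h))"
        by (subst sum.reindex) (auto simp: inj_on_def)
      also have "\<dots> \<le> (\<Sum>h=1..<H. norm (C h))"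
        by (rule sum_mono2) (use that in auto)
      finally show ?thesis .
    qed
    have "(\<Sum>l<H. norm (C (if k \<le> l then l - k else k - l)))
       = (\<Sum>l<k. norm (C (k - l))) + (norm (C 0) + (\<Sum>l=Suc k..<H. norm (C (l - k))))"
      unfolding split by (subst sum.union_disjoint; auto intro!: sum.cong)+
    then show ?thesis using 1 2 by linarith
  qed
  have "of_nat H * S = (\<Sum>k<H. \<Sum>m\<in>M. w k m)" using sumw by simp
  also have "\<dots> = (\<Sum>m\<in>M. \<Sum>k<H. w k m)" by (rule sum.swap)
  finally have "(real H * norm S)\<^sup>2 = (norm (\<Sum>m\<in>M. \<Sum>k<H. w k m))\<^sup>2"
    by (metis norm_mult norm_of_nat)
  also have "\<dots> \<le> (\<Sum>m\<in>M. 1 * norm (\<Sum>k<H. w k m))\<^sup>2"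
    by (intro power_mono) (simp_all add: norm_sum)
  also have "\<dots> \<le> (\<Sum>m\<in>M. 1\<^sup>2) * (\<Sum>m\<in>M. (norm (\<Sum>k<H. w k m))\<^sup>2)"
    by (rule Cauchy_Schwarz_ineq_sum)
  also have "\<dots> = real (b - a + H) * (\<Sum>m\<in>M. (norm (\<Sum>k<H. w k m))\<^sup>2)"
    using ab by (simp add: M_def)
  also have "(\<Sum>m\<in>M. (norm (\<Sum>k<H. w k m))\<^sup>2) \<le> real H * (norm (C 0) + 2 * (\<Sum>h=1..<H. norm (C h)))"
  proof -
    have "complex_of_real (\<Sum>m\<in>M. (norm (\<Sum>k<H. w k m))\<^sup>2) = (\<Sum>m\<in>M. (\<Sum>k<H. w k m) * cnj (\<Sum>l<H. w l m))"
      by (simp only: of_real_sum complex_norm_square)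
    also have "\<dots> = (\<Sum>m\<in>M. \<Sum>k<H. \<Sum>l<H. w k m * cnj (w l m))"
      by (simp add: sum_product)
    also have "\<dots> = (\<Sum>k<H. \<Sum>m\<in>M. \<Sum>l<H. w k m * cnj (w l m))"
      by (rule sum.swap)
    also have "\<dots> = (\<Sum>k<H. \<Sum>l<H. \<Sum>m\<in>M. w k m * cnj (w l m))"
      by (rule sum.cong[OF refl], rule sum.swap)
    finally have eq: "complex_of_real (\<Sum>m\<in>M. (norm (\<Sum>k<H. w k m))\<^sup>2) = \<dots>" .
    have "(\<Sum>m\<in>M. (norm (\<Sum>k<H. w k m))\<^sup>2) = norm (complex_of_real (\<Sum>m\<in>M. (norm (\<Sum>k<H. w k m))\<^sup>2))"
      by (subst norm_of_real) (simp add: sum_nonneg)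
    also have "\<dots> \<le> (\<Sum>k<H. \<Sum>l<H. norm (\<Sum>m\<in>M. w k m * cnj (w l m)))"
      unfolding eq by (intro order_trans[OF norm_sum] sum_mono norm_sum)
    also have "\<dots> = (\<Sum>k<H. \<Sum>l<H. norm (C (if k \<le> l then l - k else k - l)))"
      by (intro sum.cong refl corr') auto
    also have "\<dots> \<le> (\<Sum>k<H. norm (C 0) + 2 * (\<Sum>h=1..<H. norm (C h)))"
      by (intro sum_mono row) auto
    finally show ?thesis by simp
  qed
  finally have "(real H * norm S)\<^sup>2 \<le> real (b - a + H) * (real H * (norm (C 0) + 2 * (\<Sum>h=1..<H. norm (C h))))"
    by (simp add: mult_left_mono)
  then have "real H * (real H * (norm S)\<^sup>2) \<le> real H * (real (b - a + H) * (norm (C 0) + 2 * (\<Sum>h=1..<H. norm (C h))))"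
    by (simp add: power2_eq_square mult_ac)
  then show ?thesis using H unfolding S_def by (simp only: mult_le_cancel_left_pos of_nat_0_less_iff)
qed

text \<open>The second difference is a value of \<open>G''\<close>: the mean value theorem is
  applied to G(y + 1) - G(y), and then to \<open>G'\<close> on an interval of length 1.\<close>

lemma second_difference_bounds:
  fixes G G' G'' :: "real \<Rightarrow> real"
  assumes G: "\<And>y. x \<le> y \<Longrightarrow> y \<le> x + 2 \<Longrightarrow> (G has_real_derivative G' y) (at y)"
    and G': "\<And>y. x \<le> y \<Longrightarrow> y \<le> x + 2 \<Longrightarrow> (G' has_real_derivative G'' y) (at y)"
    and bd: "\<And>y. x \<le> y \<Longrightarrow> y \<le> x + 2 \<Longrightarrow> l \<le> G'' y \<and> G'' y \<le> L"
  shows "l \<le> (G (x + 2) - G (x + 1)) - (G (x + 1) - G x)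
       \<and> (G (x + 2) - G (x + 1)) - (G (x + 1) - G x) \<le> L"
proof -
  have "\<exists>z>x. z < x + 1 \<and> (G (x + 1 + 1) - G (x + 1)) - (G (x + 1) - G x) = (x + 1 - x) * (G' (z + 1) - G' z)"
    by (rule MVT2) (auto intro!: derivative_eq_intros G DERIV_chain'[where g = G and f = "\<lambda>y. y + 1" and D = 1, simplified])
  then obtain z where z: "x < z" "z < x + 1"
    "(G (x + 2) - G (x + 1)) - (G (x + 1) - G x) = G' (z + 1) - G' z"
    by (auto simp: add.assoc)
  have "\<exists>w>z. w < z + 1 \<and> G' (z + 1) - G' z = (z + 1 - z) * G'' w"
    by (rule MVT2) (use z in \<open>auto intro!: G'\<close>)
  then show ?thesis using z bd by auto
qed

section \<open>Dyadic sums of n^(-it)\<close>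

definition log_phase :: "real \<Rightarrow> nat \<Rightarrow> real" where
  "log_phase t n = - (t / (2 * pi)) * ln (real n)"

lemma cis_log_phase: "cis (2 * pi * log_phase t n) = cis (- t * ln (real n))"
  by (simp add: log_phase_def)

text \<open>The sign in \<open>log_phase\<close> makes the phase convex, as the test requires. Its
  second derivative t / (2 pi y^2) varies by a factor of at most 4 on [M, 2M], with minimum
  \<open>l\<close>.\<close>

lemma log_sum_second_derivative:
  assumes "0 < t" "1 \<le> M" "M \<le> a" "b \<le> 2 * M" "t / (8 * pi * real M ^ 2) \<le> 1"
  defines "l \<equiv> t / (8 * pi * real M ^ 2)"
  shows "norm (\<Sum>n=a..<b. cis (- t * ln (real n))) \<le> 9 * (4 * l * real M + 2) / sqrt l"
proof -
  have "l > 0" using assms by (simp add: l_def)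
  have "norm (\<Sum>n=a..<b. cis (2 * pi * log_phase t n)) \<le> 9 * (4 * l * real M + 2) / sqrt l"
  proof (rule second_difference_test)
    fix n assume n: "a \<le> n" "Suc n < b"
    let ?G = "\<lambda>x. - (t / (2 * pi)) * ln x"
    have M: "real M \<le> real n" "real n + 2 \<le> 2 * real M" "0 < real M" using n assms by linarith+
    have "l \<le> (?G (real n + 2) - ?G (real n + 1)) - (?G (real n + 1) - ?G (real n))
       \<and> (?G (real n + 2) - ?G (real n + 1)) - (?G (real n + 1) - ?G (real n)) \<le> 4 * l"
    proof (rule second_difference_bounds)
      fix y assume y: "real n \<le> y" "y \<le> real n + 2"
      have y0: "0 < y" using M y by linarith
      show "(?G has_real_derivative - (t / (2 * pi)) * (1 / y)) (at y)"
        using y0 by (auto intro!: derivative_eq_intros)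
      show "((\<lambda>y. - (t / (2 * pi)) * (1 / y)) has_real_derivative (t / (2 * pi)) * (1 / y ^ 2)) (at y)"
        using y0 by (auto intro!: derivative_eq_intros simp: power2_eq_square)
      have "real M ^ 2 \<le> y ^ 2" using M y by (intro power_mono) auto
      moreover have "y ^ 2 \<le> (2 * real M) ^ 2" using M y by (intro power_mono) auto
      ultimately have "1 / (4 * real M ^ 2) \<le> 1 / y ^ 2 \<and> 1 / y ^ 2 \<le> 1 / real M ^ 2"
        using M y0 by (auto intro!: divide_left_mono simp: power_mult_distrib)
      then have "t / (2 * pi) * (1 / (4 * real M ^ 2)) \<le> t / (2 * pi) * (1 / y ^ 2)
         \<and> t / (2 * pi) * (1 / y ^ 2) \<le> t / (2 * pi) * (1 / real M ^ 2)"
        using assms(1) by (intro conjI mult_left_mono) auto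
      then show "l \<le> (t / (2 * pi)) * (1 / y ^ 2) \<and> (t / (2 * pi)) * (1 / y ^ 2) \<le> 4 * l"
        unfolding l_def by (simp only: times_divide_times_eq mult_1_right times_divide_eq_right) (simp add: mult_ac)
    qed
    then show "l \<le> log_phase t (Suc (Suc n)) - log_phase t (Suc n) - (log_phase t (Suc n) - log_phase t n) \<and>
         log_phase t (Suc (Suc n)) - log_phase t (Suc n) - (log_phase t (Suc n) - log_phase t n) \<le> 4 * l"
      by (simp add: log_phase_def add_ac)
  qed (use \<open>l > 0\<close> assms in auto)
  then show ?thesis by (simp add: cis_log_phase)
qed

text \<open>With w = y + h the second derivative is t / (2 pi) * (1/y^2 - 1/w^2) = t h / (2 pi) *
  (1/(y w^2) + 1/(y^2 w)), so it varies by a factor of at most 8 on the block and has size h t /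
  M^3.\<close>

lemma log_correlation_bound:
  assumes "0 < t" "1 \<le> M" "M \<le> a" "b \<le> 2 * M" "1 \<le> h"
    and "real h * (t / (8 * pi * real M ^ 3)) \<le> 1"
  defines "l \<equiv> real h * (t / (8 * pi * real M ^ 3))"
  shows "norm (\<Sum>n=a..<b-h. cis (- t * ln (real (n + h))) * cnj (cis (- t * ln (real n))))
    \<le> 9 * (8 * l * real M + 2) / sqrt l"
proof -
  have "l > 0" using assms by (simp add: l_def)
  define g where "g = (\<lambda>n. t / (2 * pi) * (ln (real n + real h) - ln (real n)))"
  have "norm (\<Sum>n=a..<b-h. cis (2 * pi * g n)) \<le> 9 * (8 * l * real M + 2) / sqrt l"
  proof (rule second_difference_test)
    fix n assume n: "a \<le> n" "Suc n < b - h"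
    let ?G = "\<lambda>x. t / (2 * pi) * (ln (x + real h) - ln x)"
    have M: "real M \<le> real n" "real n + 2 + real h \<le> 2 * real M" "0 < real M" "0 < real h"
      using n assms by linarith+
    have "l \<le> (?G (real n + 2) - ?G (real n + 1)) - (?G (real n + 1) - ?G (real n))
       \<and> (?G (real n + 2) - ?G (real n + 1)) - (?G (real n + 1) - ?G (real n)) \<le> 8 * l"
    proof (rule second_difference_bounds)
      fix y assume y: "real n \<le> y" "y \<le> real n + 2"
      define w where "w = y + real h"
      have y0: "0 < y" and w0: "0 < w" using M y by (auto simp: w_def)
      show "(?G has_real_derivative t / (2 * pi) * (1 / (y + real h) - 1 / y)) (at y)"
        using y0 w0[unfolded w_def] by (auto intro!: derivative_eq_intros)
      show "((\<lambda>y. t / (2 * pi) * (1 / (y + real h) - 1 / y)) has_real_derivative (t / (2 * pi)) * (1 / y ^ 2 - 1 / (y + real h) ^ 2)) (at y)"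
        using y0 w0[unfolded w_def] by (auto intro!: derivative_eq_intros simp: power2_eq_square)
      have rng: "real M \<le> y" "y \<le> 2 * real M" "real M \<le> w" "w \<le> 2 * real M"
        using M y by (auto simp: w_def)
      have up: "real M ^ 3 \<le> y * w ^ 2" "real M ^ 3 \<le> y ^ 2 * w"
      proof -
        have "real M * real M ^ 2 \<le> y * w ^ 2" using rng M by (intro mult_mono power_mono) auto
        then show "real M ^ 3 \<le> y * w ^ 2" by (simp add: power3_eq_cube power2_eq_square)
        have "real M ^ 2 * real M \<le> y ^ 2 * w" using rng M by (intro mult_mono power_mono) auto
        then show "real M ^ 3 \<le> y ^ 2 * w" by (simp add: power3_eq_cube power2_eq_square)
      qed
      have lo: "y * w ^ 2 \<le> 8 * real M ^ 3" "y ^ 2 * w \<le> 8 * real M ^ 3"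
      proof -
        have "y * w ^ 2 \<le> (2 * real M) * (2 * real M) ^ 2" using rng M y0 w0 by (intro mult_mono power_mono) auto
        then show "y * w ^ 2 \<le> 8 * real M ^ 3" by (simp add: power3_eq_cube power2_eq_square)
        have "y ^ 2 * w \<le> (2 * real M) ^ 2 * (2 * real M)" using rng M y0 w0 by (intro mult_mono power_mono) auto
        then show "y ^ 2 * w \<le> 8 * real M ^ 3" by (simp add: power3_eq_cube power2_eq_square)
      qed
      have eq: "1 / y ^ 2 - 1 / w ^ 2 = real h * (1 / (y * w ^ 2) + 1 / (y ^ 2 * w))"
      proof -
        have "real h = w - y" by (simp add: w_def)
        then show ?thesis using y0 w0 by (simp add: divide_simps power2_eq_square) (simp add: algebra_simps)
      qed
      have "2 / (8 * real M ^ 3) \<le> 1 / (y * w ^ 2) + 1 / (y ^ 2 * w)"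
      proof -
        have "1 / (8 * real M ^ 3) \<le> 1 / (y * w ^ 2)" "1 / (8 * real M ^ 3) \<le> 1 / (y ^ 2 * w)"
          using lo y0 w0 M by (auto intro!: divide_left_mono mult_pos_pos)
        then show ?thesis by linarith
      qed
      moreover have "1 / (y * w ^ 2) + 1 / (y ^ 2 * w) \<le> 2 / real M ^ 3"
      proof -
        have "1 / (y * w ^ 2) \<le> 1 / real M ^ 3" "1 / (y ^ 2 * w) \<le> 1 / real M ^ 3"
          using up y0 w0 M by (auto intro!: divide_left_mono mult_pos_pos)
        then show ?thesis by linarith
      qed
      ultimately have "t / (2 * pi) * (real h * (2 / (8 * real M ^ 3))) \<le> t / (2 * pi) * (1 / y ^ 2 - 1 / w ^ 2)
         \<and> t / (2 * pi) * (1 / y ^ 2 - 1 / w ^ 2) \<le> t / (2 * pi) * (real h * (2 / real M ^ 3))"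
        using assms(1) M unfolding eq by (intro conjI mult_left_mono) auto
      then show "l \<le> (t / (2 * pi)) * (1 / y ^ 2 - 1 / (y + real h) ^ 2) \<and>
           (t / (2 * pi)) * (1 / y ^ 2 - 1 / (y + real h) ^ 2) \<le> 8 * l"
        unfolding l_def w_def by (simp add: field_simps)
    qed
    then show "l \<le> g (Suc (Suc n)) - g (Suc n) - (g (Suc n) - g n) \<and>
         g (Suc (Suc n)) - g (Suc n) - (g (Suc n) - g n) \<le> 8 * l"
      by (simp add: g_def add_ac)
  qed (use \<open>l > 0\<close> assms in auto)
  \<comment> \<open>The correlation itself has a concave phase; conjugation makes it convex and
    leaves the norm unchanged.\<close>
  moreover have "norm (\<Sum>n=a..<b-h. cis (- t * ln (real (n + h))) * cnj (cis (- t * ln (real n))))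
     = norm (cnj (\<Sum>n=a..<b-h. cis (2 * pi * g n)))"
    unfolding cnj_sum
    by (intro arg_cong[where f = norm] sum.cong) (auto simp: cis_cnj cis_mult g_def algebra_simps)
  ultimately show ?thesis by (simp only: complex_mod_cnj)
qed

lemma sum_inverse_sqrt_le: "(\<Sum>h=1..H. 1 / sqrt (real h)) \<le> 2 * sqrt (real H)"
proof (induction H)
  case (Suc H)
  let ?x = "sqrt (real H)" and ?y = "sqrt (real H + 1)"
  have "2 * ?x * ?y \<le> ?x\<^sup>2 + ?y\<^sup>2" by (rule sum_squares_bound)
  then have "2 * ?x * ?y + 1 \<le> 2 * ?y * ?y"
    by (simp add: mult.assoc)
  then have "2 * ?x + 1 / ?y \<le> 2 * ?y" by (simp add: field_simps)
  then show ?case using Suc by (simp add: add_ac)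
qed simp

text \<open>Here M lies between t^(1/3) and t^(2/3). For H shifts the diagonal contributes M^2/H to
  the square of the sum, so M q^2 is reached with H about M/q^2, provided that the correlations for
  h < H add up to O(M).\<close>

lemma log_sum_middle_range:
  assumes "1 \<le> q" "1 \<le> M" "M \<le> a" "b \<le> 2 * M" "q ^ 2 \<le> real M" "real M \<le> q ^ 4"
  shows "norm (\<Sum>n=a..<b. cis (- (q ^ 6) * ln (real n))) \<le> 45 * (sqrt (real M) * q)"
proof (cases "a \<le> b")
  case False then show ?thesis using assms by simp
next
  case True
  define m where "m = sqrt (real M)"
  have m: "m > 0" "m ^ 2 = real M" using assms by (auto simp: m_def)
  have q: "q > 0" using assms by simp
  define c where "c = sqrt (8 * pi)"
  have c2: "c ^ 2 = 8 * pi" by (simp add: c_def)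
  \<comment> \<open>The square root of 8 pi is about 5.01; the upper bound serves 18 * 5.2 <=
    94.\<close>
  have c: "5 \<le> c" "c \<le> 5.2"
    unfolding c_def using pi_approx
    by (intro real_le_rsqrt real_le_lsqrt; simp add: power2_eq_square)+
  \<comment> \<open>Rounding up at most doubles the value, because q^2 <= M.\<close>
  define H where "H = nat \<lceil>real M / q ^ 2\<rceil>"
  have Mq: "1 \<le> real M / q ^ 2" using assms q by simp
  have H1: "real M / q ^ 2 \<le> real H" unfolding H_def using Mq by linarith
  have "real H \<le> real M / q ^ 2 + 1" unfolding H_def using Mq by linarith
  then have H2: "real H \<le> 2 * (real M / q ^ 2)" using Mq by linarith
  have H0: "0 < H" using H1 Mq by (cases H) auto
  have sqH: "sqrt (real H) \<le> 3 / 2 * m / q"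
  proof (rule real_le_lsqrt)
    have "(3 / 2 * m / q)\<^sup>2 = 9 / 4 * (real M / q ^ 2)"
      by (simp add: power_divide power_mult_distrib m(2))
    then show "real H \<le> (3 / 2 * m / q)\<^sup>2" using H2 Mq by linarith
  qed (use m q in auto)
  define C where "C = (\<lambda>h. \<Sum>n=a..<b-h. cis (- (q ^ 6) * ln (real (n + h))) * cnj (cis (- (q ^ 6) * ln (real n))))"
  have Cb: "norm (C h) \<le> 22 * q ^ 2 + 94 * (real M * m / q ^ 3) * (1 / sqrt (real h))" if h: "1 \<le> h" "h < H" for h
  proof -
    define l where "l = real h * (q ^ 6 / (8 * pi * real M ^ 3))"
    define s where "s = sqrt (real h)"
    have s: "0 < s" "s ^ 2 = real h" using h by (auto simp: s_def)
    have sH: "s \<le> 3 / 2 * m / q" using h sqH unfolding s_def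
      by (meson less_imp_le order_trans of_nat_mono real_sqrt_le_mono)
    have sl: "sqrt l = s * q ^ 3 / (c * (real M * m))"
    proof (rule real_sqrt_unique)
      have "(s * q ^ 3 / (c * (real M * m)))\<^sup>2 = (s ^ 2 * q ^ 6) / (c ^ 2 * (real M ^ 2 * m ^ 2))"
        by (simp add: power_divide power_mult_distrib flip: power_mult)
      also have "\<dots> = l" unfolding c2 s(2) m(2) l_def by (simp add: power2_eq_square power3_eq_cube)
      finally show "(s * q ^ 3 / (c * (real M * m)))\<^sup>2 = l" .
    qed (use s q c m in auto)
    have ll: "l = (sqrt l) ^ 2" using q by (simp add: l_def)
    \<comment> \<open>For h < H the main term M * sqrt(l) of the second derivative test is at most
      of order q^2, so that H such terms cost O(M), the size of the diagonal. The same estimate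
      yields l <= 1.\<close>
    have Msl: "real M * sqrt l \<le> 0.3 * q ^ 2"
    proof -
      have "real M * sqrt l = s * q ^ 3 / (c * m)" unfolding sl using assms by simp
      also have "\<dots> \<le> (3 / 2 * m / q) * q ^ 3 / (5 * m)"
        using sH c m q s by (intro frac_le mult_mono) auto
      also have "\<dots> = 0.3 * q ^ 2" using m q by (simp add: field_simps power2_eq_square power3_eq_cube)
      finally show ?thesis .
    qed
    have slpos: "0 < sqrt l" unfolding sl using s q c m assms by simp
    have "l \<le> 1"
    proof -
      have "real M * sqrt l \<le> real M * 1" using Msl assms by linarith
      then have "sqrt l \<le> 1" using assms by (simp only: mult_le_cancel_left_pos of_nat_0_less_iff)
      then show ?thesis by simp
    qed
    have "norm (C h) \<le> 9 * (8 * l * real M + 2) / sqrt l"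
      unfolding C_def l_def by (rule log_correlation_bound) (use assms h \<open>l \<le> 1\<close> in \<open>auto simp: l_def\<close>)
    also have "\<dots> = 72 * (real M * sqrt l) + 18 / sqrt l"
      using slpos by (subst ll) (simp add: field_simps power2_eq_square)
    also have "\<dots> \<le> 72 * (0.3 * q ^ 2) + 18 / sqrt l" using Msl by linarith
    also have "18 / sqrt l = 18 * c * (real M * m / q ^ 3) * (1 / s)"
      unfolding sl by (simp add: mult_ac)
    also have "\<dots> \<le> 94 * (real M * m / q ^ 3) * (1 / s)"
      using c m q s by (intro mult_right_mono) auto
    finally show ?thesis unfolding s_def using zero_le_power2[of q] by linarith
  qed
  \<comment> \<open>The terms 1/sqrt(l) add up to a multiple of M^2/q^4; here M <= q^4 is
    used.\<close>
  have M4: "real M * m / q ^ 3 * (m / q) \<le> real M"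
  proof -
    have "real M * m / q ^ 3 * (m / q) = real M * (m ^ 2 / q ^ 4)" by (simp add: power2_eq_square power3_eq_cube power4_eq_xxxx)
    also have "\<dots> \<le> real M * 1" using m assms q by (intro mult_left_mono) auto
    finally show ?thesis by simp
  qed
  have "(\<Sum>h=1..<H. norm (C h)) \<le> (\<Sum>h=1..<H. 22 * q ^ 2 + 94 * (real M * m / q ^ 3) * (1 / sqrt (real h)))"
    by (intro sum_mono Cb) auto
  also have "\<dots> \<le> (\<Sum>h=1..H. 22 * q ^ 2 + 94 * (real M * m / q ^ 3) * (1 / sqrt (real h)))"
    using m q by (intro sum_mono2) auto
  also have "\<dots> = real H * (22 * q ^ 2) + 94 * (real M * m / q ^ 3) * (\<Sum>h=1..H. 1 / sqrt (real h))"
    by (simp only: sum.distrib sum_distrib_left) simp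
  also have "\<dots> \<le> (2 * (real M / q ^ 2)) * (22 * q ^ 2) + 94 * (real M * m / q ^ 3) * (3 * (m / q))"
  proof (intro add_mono mult_right_mono mult_left_mono)
    show "(\<Sum>h=1..H. 1 / sqrt (real h)) \<le> 3 * (m / q)"
      using sum_inverse_sqrt_le[of H] sqH by simp
  qed (use H2 m q in auto)
  also have "\<dots> = 44 * real M + 282 * (real M * m / q ^ 3 * (m / q))" using q by simp
  also have "\<dots> \<le> 326 * real M" using M4 by linarith
  finally have sumC: "(\<Sum>h=1..<H. norm (C h)) \<le> 326 * real M" .
  have C0: "norm (C 0) \<le> real M"
  proof -
    have "norm (C 0) \<le> (\<Sum>n=a..<b. 1)"
      unfolding C_def by (rule order_trans[OF norm_sum]) (simp add: norm_mult)
    also have "\<dots> \<le> real M" using assms True by auto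
    finally show ?thesis .
  qed
  define S where "S = norm (\<Sum>n=a..<b. cis (- (q ^ 6) * ln (real n)))"
  have "real M / q ^ 2 * S ^ 2 \<le> real H * S ^ 2" using H1 by (intro mult_right_mono) auto
  also have "\<dots> \<le> real (b - a + H) * (norm (C 0) + 2 * (\<Sum>h=1..<H. norm (C h)))"
    unfolding S_def C_def by (rule van_der_corput_inequality[OF H0 True])
  \<comment> \<open>653 = 1 + 2 * 326, and the product 3 * 653 = 1959 is below 45^2 = 2025.\<close>
  also have "\<dots> \<le> (3 * real M) * (653 * real M)"
  proof (intro mult_mono)
    have "1 \<le> q ^ 2" using assms(1) by simp
    then have "real M / q ^ 2 \<le> real M / 1" using assms by (intro divide_left_mono) auto
    then have "real H \<le> 2 * real M" using H2 by simp
    moreover have "real (b - a) \<le> real M" using assms by linarith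
    ultimately show "real (b - a + H) \<le> 3 * real M" by simp
    show "norm (C 0) + 2 * (\<Sum>h=1..<H. norm (C h)) \<le> 653 * real M" using sumC C0 by linarith
  qed (auto intro!: add_nonneg_nonneg sum_nonneg)
  finally have "real M * S ^ 2 \<le> real M * (1959 * (real M * q ^ 2))"
    using q by (simp add: field_simps)
  then have "S ^ 2 \<le> 1959 * (real M * q ^ 2)" using assms by (simp only: mult_le_cancel_left_pos of_nat_0_less_iff)
  also have "\<dots> \<le> (45 * (m * q)) ^ 2" by (simp add: power_mult_distrib m(2))
  finally have "S \<le> 45 * (m * q)" using m q by (intro power2_le_imp_le[of S]) auto
  then show ?thesis unfolding S_def m_def .
qed

text \<open>For M between t^(2/3) and t the second derivative test alone suffices: its two terms are
  of order q^3 and M/q^3, and both are O(sqrt(M) * q) since q^2 <= sqrt(M) <= q^3.\<close>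

lemma log_sum_upper_range:
  assumes "1 \<le> q" "1 \<le> M" "M \<le> a" "b \<le> 2 * M" "q ^ 4 \<le> real M" "real M \<le> q ^ 6"
  shows "norm (\<Sum>n=a..<b. cis (- (q ^ 6) * ln (real n))) \<le> 102 * (sqrt (real M) * q)"
proof -
  define m where "m = sqrt (real M)"
  have m: "m > 0" "m ^ 2 = real M" using assms by (auto simp: m_def)
  have q: "q > 0" using assms by simp
  define c where "c = sqrt (8 * pi)"
  have c2: "c ^ 2 = 8 * pi" by (simp add: c_def)
  have c: "5 \<le> c" "c \<le> 5.2"
    unfolding c_def using pi_approx
    by (intro real_le_rsqrt real_le_lsqrt; simp add: power2_eq_square)+
  have m1: "q ^ 2 \<le> m" unfolding m_def by (rule real_le_rsqrt) (use assms in \<open>simp flip: power_mult\<close>)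
  have m2: "m \<le> q ^ 3" unfolding m_def by (rule real_le_lsqrt) (use assms in \<open>simp_all flip: power_mult\<close>)
  define l where "l = q ^ 6 / (8 * pi * real M ^ 2)"
  have sl: "sqrt l = q ^ 3 / (c * real M)"
  proof (rule real_sqrt_unique)
    show "(q ^ 3 / (c * real M))\<^sup>2 = l"
      unfolding l_def by (simp add: power_divide power_mult_distrib c2 flip: power_mult)
  qed (use q c in auto)
  have slpos: "0 < sqrt l" unfolding sl using q c assms by simp
  have "sqrt l \<le> 1"
  proof -
    have "q ^ 3 \<le> q ^ 4" using assms(1) by (intro power_increasing) auto
    also have "\<dots> \<le> real M" by fact
    also have "\<dots> \<le> c * real M" using c by (simp add: mult_le_cancel_right1)
    finally show ?thesis unfolding sl using c assms by simp
  qed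
  then have "l \<le> 1" by simp
  have ll: "l = (sqrt l) ^ 2" using slpos by simp
  have "norm (\<Sum>n=a..<b. cis (- (q ^ 6) * ln (real n))) \<le> 9 * (4 * l * real M + 2) / sqrt l"
    unfolding l_def by (rule log_sum_second_derivative) (use assms \<open>l \<le> 1\<close> in \<open>auto simp: l_def\<close>)
  also have "\<dots> = 36 * (real M * sqrt l) + 18 / sqrt l"
    using slpos by (subst ll) (simp add: field_simps power2_eq_square)
  also have "real M * sqrt l = q ^ 3 / c" unfolding sl using assms by simp
  also have "\<dots> \<le> q ^ 3 / 5" using c q by (intro divide_left_mono) auto
  also have "q ^ 3 / 5 \<le> m * q / 5" using m1 q by (simp add: power3_eq_cube power2_eq_square)
  also have "18 / sqrt l = 18 * c * (m ^ 2 / q ^ 3)" unfolding sl m(2) by simp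
  also have "\<dots> \<le> 94 * (m * 1)"
  proof (intro mult_mono)
    have "m ^ 2 / q ^ 3 = m * (m / q ^ 3)" by (simp add: power2_eq_square)
    also have "\<dots> \<le> m * 1" using m m2 q by (intro mult_left_mono) auto
    finally show "m ^ 2 / q ^ 3 \<le> m * 1" .
  qed (use c m q in auto)
  also have "m * 1 \<le> m * q" using m assms by (intro mult_left_mono) auto
  finally have "norm (\<Sum>n=a..<b. cis (- (q ^ 6) * ln (real n))) \<le> 36 * (m * q / 5) + 94 * (m * q)"
    by simp
  moreover have "0 \<le> m * q" using m q by simp
  ultimately show ?thesis unfolding m_def[symmetric] by linarith
qed

text \<open>Below q^2 the number of terms, M = sqrt(M) * sqrt(M), is already small enough.\<close>

theorem log_sum_weyl_bound:
  assumes "1 \<le> q" "1 \<le> M" "M \<le> a" "b \<le> 2 * M" "real M \<le> q ^ 6"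
  shows "norm (\<Sum>n=a..<b. cis (- (q ^ 6) * ln (real n))) \<le> 102 * (sqrt (real M) * q)"
proof -
  have nn: "0 \<le> sqrt (real M) * q" using assms by simp
  consider "real M \<le> q ^ 2" | "q ^ 2 \<le> real M" "real M \<le> q ^ 4" | "q ^ 4 \<le> real M" by linarith
  then show ?thesis
  proof cases
    case 1
    have "norm (\<Sum>n=a..<b. cis (- (q ^ 6) * ln (real n))) \<le> real (card {a..<b})"
      by (rule norm_sum_cis_le_card)
    also have "\<dots> \<le> real M" using assms by simp
    also have "\<dots> = sqrt (real M) * sqrt (real M)" by simp
    also have "\<dots> \<le> sqrt (real M) * q"
      using 1 assms by (intro mult_left_mono real_le_lsqrt) auto
    finally show ?thesis using nn by linarith
  next
    case 2 then show ?thesis using log_sum_middle_range[OF assms(1-4)] nn by force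
  next
    case 3 then show ?thesis using log_sum_upper_range[OF assms(1-4)] assms by simp
  qed
qed

text \<open>Once M >= t the increments of the phase lie in [-2r, -r], strictly between the integers
  -1 and 0, and Kusmin-Landau applies directly with \<open>k = -1\<close>.\<close>

theorem log_sum_long_bound:
  assumes "1 \<le> t" "1 \<le> M" "M \<le> a" "b \<le> 2 * M" "t \<le> real M"
  shows "norm (\<Sum>n=a..<b. cis (- t * ln (real n))) \<le> 40 * (real M / t)"
proof -
  define r where "r = t / (4 * pi * real M)"
  have r: "0 < r" using assms by (simp add: r_def)
  have "norm (\<Sum>n=a..<b. cis (2 * pi * log_phase t n)) \<le> 3 / r"
  proof (rule kusmin_landau[where k = "-1"])
    have dd: "log_phase t (Suc n) - log_phase t n = - (t / (2 * pi)) * ln (1 + 1 / real n)" if "n > 0" for n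
    proof -
      have "ln (1 + 1 / real n) = ln (real (Suc n) / real n)" using that by (simp add: field_simps)
      also have "\<dots> = ln (real (Suc n)) - ln (real n)" using that by (simp add: ln_div)
      finally show ?thesis by (simp add: log_phase_def right_diff_distrib)
    qed
    fix n
    {
      assume n: "a \<le> n" "Suc n < b"
      have "n > 0" using n assms by linarith
      have "ln (1 + 1 / real (Suc n)) \<le> ln (1 + 1 / real n)"
        using \<open>n > 0\<close> by (intro ln_mono add_left_mono divide_left_mono add_pos_nonneg) auto
      then show "log_phase t (Suc n) - log_phase t n \<le> log_phase t (Suc (Suc n)) - log_phase t (Suc n)"
        unfolding dd[OF \<open>n > 0\<close>] dd[OF zero_less_Suc] using assms by (intro mult_left_mono_neg) auto
    }
    assume n: "a \<le> n" "n < b"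
    have "n > 0" using n assms by linarith
    have le: "ln (1 + 1 / real n) \<le> 1 / real M"
    proof -
      have "ln (1 + 1 / real n) \<le> 1 / real n" by (rule ln_add_one_self_le_self) simp
      also have "\<dots> \<le> 1 / real M" using n assms by (intro divide_left_mono) auto
      finally show ?thesis .
    qed
    have ge: "1 / (2 * real M) \<le> ln (1 + 1 / real n)"
    proof -
      have "1 / (2 * real M) \<le> 1 / (real n + 1)" using n assms by (intro divide_left_mono) auto
      also have "\<dots> = 1 - 1 / (1 + 1 / real n)" using \<open>n > 0\<close> by (simp add: field_simps)
      also have "\<dots> \<le> ln (1 + 1 / real n)"
      proof -
        have "1 + 1 / real n > 0" by (simp add: add_pos_nonneg)
        then have "- ln (1 + 1 / real n) \<le> inverse (1 + 1 / real n) - 1"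
          using ln_le_minus_one[of "inverse (1 + 1 / real n)"] by (simp add: ln_inverse)
        then show ?thesis by (simp add: inverse_eq_divide)
      qed
      finally show ?thesis .
    qed
    have "t / (2 * pi) * ln (1 + 1 / real n) \<le> t / (2 * pi) * (1 / real M)"
      "t / (2 * pi) * (1 / (2 * real M)) \<le> t / (2 * pi) * ln (1 + 1 / real n)"
      using le ge assms by (intro mult_left_mono; simp)+
    then have 1: "r \<le> t / (2 * pi) * ln (1 + 1 / real n)" and 2: "t / (2 * pi) * ln (1 + 1 / real n) \<le> 2 * r"
      by (auto simp: r_def)
    \<comment> \<open>Says that -2r >= -1 + r, the distance required from the integer -1.\<close>
    have "3 * r \<le> 1"
    proof -
      have "3 * t \<le> 4 * 3 * real M" using assms by simp
      also have "\<dots> \<le> 4 * pi * real M" using pi_gt3 by (intro mult_right_mono) auto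
      finally show ?thesis using assms by (simp add: r_def)
    qed
    then show "real_of_int (- 1) + r \<le> log_phase t (Suc n) - log_phase t n
        \<and> log_phase t (Suc n) - log_phase t n \<le> real_of_int (- 1) + 1 - r"
      unfolding dd[OF \<open>n > 0\<close>] using 1 2 by simp
  qed (rule r)
  also have "3 / r = 12 * pi * (real M / t)" by (simp add: r_def)
  also have "\<dots> \<le> 40 * (real M / t)" using pi_approx assms by (intro mult_right_mono) auto
  finally show ?thesis by (simp add: cis_log_phase)
qed

section \<open>The zeta function in the half-plane of positive real part\<close>

text \<open>The extra term continues analytically the tail integral of x^(-s) over [N, \<infinity>),
  so this is the first Euler-Maclaurin approximation to zeta.\<close>

definition zeta_partial :: "nat \<Rightarrow> complex \<Rightarrow> complex" where
  "zeta_partial N s = (\<Sum>n=1..N. of_nat n powr (- s)) + of_nat N powr (1 - s) / (s - 1)"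

lemma has_vector_derivative_of_real_powr:
  assumes "0 < x"
  shows "((\<lambda>x. complex_of_real x powr a) has_vector_derivative a * of_real x powr (a - 1)) (at x within S)"
  using assms
  by (intro has_vector_derivative_real_field has_field_derivative_powr) auto

text \<open>On a unit interval frac x = x - n has an explicit primitive, and the resulting values
  are differences of consecutive \<open>zeta_partial\<close>, ready to telescope.\<close>

lemma has_integral_frac_powr_unit:
  fixes s :: complex
  assumes s: "s \<noteq> 0" "s \<noteq> 1" and n: "1 \<le> n"
  shows "((\<lambda>x. of_real (frac x) * of_real x powr (- s - 1)) has_integral
    (zeta_partial n s - zeta_partial (Suc n) s) / s) {real n..real (Suc n)}"
proof -
  define F where "F = (\<lambda>x. complex_of_real x powr (1 - s) / (1 - s) + of_nat n * (complex_of_real x powr (- s) / s))"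
  have "((\<lambda>x. of_real (x - real n) * of_real x powr (- s - 1)) has_integral (F (real (Suc n)) - F (real n))) {real n..real (Suc n)}"
  proof (rule fundamental_theorem_of_calculus)
    fix x assume x: "x \<in> {real n..real (Suc n)}"
    then have x0: "0 < x" using n by auto
    have p: "complex_of_real x powr (- s) = of_real x * of_real x powr (- s - 1)"
      using x0 by (subst powr_diff) auto
    have "(F has_vector_derivative ((1 - s) * of_real x powr (1 - s - 1) / (1 - s)
        + of_nat n * ((- s) * of_real x powr (- s - 1) / s))) (at x within {real n..real (Suc n)})"
      unfolding F_def
      by (intro has_vector_derivative_add has_vector_derivative_mult_right has_vector_derivative_divide
           has_vector_derivative_of_real_powr x0)
    also have "(1 - s) * of_real x powr (1 - s - 1) / (1 - s) + of_nat n * ((- s) * of_real x powr (- s - 1) / s)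
       = of_real (x - real n) * of_real x powr (- s - 1)"
    proof -
      have "(1 - s) * of_real x powr (1 - s - 1) / (1 - s) = of_real x powr (- s)" using s by simp
      then show ?thesis using s by (simp add: p left_diff_distrib)
    qed
    finally show "(F has_vector_derivative of_real (x - real n) * of_real x powr (- s - 1)) (at x within {real n..real (Suc n)})" .
  qed simp
  moreover have "F (real (Suc n)) - F (real n) = (zeta_partial n s - zeta_partial (Suc n) s) / s"
  proof -
    define A B A' B' where "A = of_nat n powr (1 - s)" and "B = of_nat n powr (- s)"
      and "A' = of_nat (Suc n) powr (1 - s)" and "B' = of_nat (Suc n) powr (- s)"
    have rel: "A = of_nat n * B" "A' = (of_nat n + 1) * B'"
    proof -
      show "A = of_nat n * B"
        using n unfolding A_def B_def by (simp add: powr_diff powr_minus divide_inverse)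
      have "A' = of_nat (Suc n) * B'"
        unfolding A'_def B'_def by (simp add: powr_diff powr_minus divide_inverse del: of_nat_Suc)
      then show "A' = (of_nat n + 1) * B'" by (simp add: add.commute)
    qed
    have F: "F (real (Suc n)) - F (real n) = A' / (1 - s) + of_nat n * (B' / s) - (A / (1 - s) + of_nat n * (B / s))"
      unfolding F_def A_def B_def A'_def B'_def of_real_of_nat_eq ..
    have Z: "zeta_partial n s - zeta_partial (Suc n) s = A / (s - 1) - (B' + A' / (s - 1))"
      unfolding zeta_partial_def A_def A'_def B'_def by simp
    have "1 - s \<noteq> 0" "s - 1 \<noteq> 0" using s by auto
    then show ?thesis
      unfolding F Z rel using s by (simp add: divide_simps) (simp add: algebra_simps)
  qed
  ultimately have "((\<lambda>x. of_real (x - real n) * of_real x powr (- s - 1)) has_integral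
      (zeta_partial n s - zeta_partial (Suc n) s) / s) {real n..real (Suc n)}" by simp
  then show ?thesis
  \<comment> \<open>At the right end point frac jumps to 0 while x - n equals 1, so one point is
    exempted.\<close>
  proof (rule has_integral_spike_finite[rotated 2])
    fix x assume "x \<in> {real n..real (Suc n)} - {real (Suc n)}"
    then have "\<lfloor>x\<rfloor> = int n" by (auto simp: floor_eq_iff)
    then show "of_real (frac x) * of_real x powr (- s - 1) = of_real (x - real n) * complex_of_real x powr (- s - 1)"
      by (simp add: frac_def)
  qed simp
qed

lemma has_integral_frac_powr:
  fixes s :: complex
  assumes s: "s \<noteq> 0" "s \<noteq> 1" and N: "1 \<le> N"
  shows "((\<lambda>x. of_real (frac x) * of_real x powr (- s - 1)) has_integral
    (s / (s - 1) - zeta_partial N s) / s) {1..real N}"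
  using N
proof (induction N rule: dec_induct)
  case base
  have "s - 1 \<noteq> 0" using s by simp
  then have "s / (s - 1) = zeta_partial 1 s" by (simp add: zeta_partial_def divide_simps)
  then show ?case using has_integral_refl(1)[of _ 1] by (simp add: cbox_interval[symmetric] del: cbox_interval)
next
  case (step n)
  have "((\<lambda>x. of_real (frac x) * of_real x powr (- s - 1)) has_integral
    ((s / (s - 1) - zeta_partial n s) / s + (zeta_partial n s - zeta_partial (Suc n) s) / s)) {1..real (Suc n)}"
    using step by (intro has_integral_combine[of 1 "real n"] has_integral_frac_powr_unit s) auto
  then show ?case by (simp add: diff_divide_distrib)
qed

lemma norm_frac_powr_le:
  "1 \<le> x \<Longrightarrow> norm (of_real (frac x) * complex_of_real x powr (- s - 1)) \<le> x powr (- Re s - 1)"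
  using frac_lt_1[of x] frac_ge_0[of x]
  by (simp add: norm_mult norm_powr_real_powr mult_left_le_one_le)

text \<open>Domination by x^(-Re s - 1) handles infinity; on bounded pieces integrability comes from
  the closed form up to an integer beyond the piece.\<close>

lemma frac_powr_integrable:
  fixes s :: complex
  assumes s: "0 < Re s" "s \<noteq> 1" and a: "1 \<le> a"
  shows "(\<lambda>x. of_real (frac x) * of_real x powr (- s - 1)) integrable_on {a..}"
proof (rule integrable_on_all_intervals_integrable_bound)
  let ?f = "\<lambda>x. of_real (frac x) * complex_of_real x powr (- s - 1)"
  have s0: "s \<noteq> 0" using s by auto
  show "(\<lambda>x. x powr (- Re s - 1)) integrable_on {a..}"
    using has_integral_powr_to_inf[of "- Re s - 1" a] s a by (auto simp: integrable_on_def)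
  show "norm (?f x) \<le> x powr (- Re s - 1)" if "x \<in> {a..}" for x
    using that a by (intro norm_frac_powr_le) auto
  fix c d :: real
  obtain N where N: "d \<le> real N" "1 \<le> N"
    by (meson le_cases nat_le_real_less of_nat_0_le_iff order_trans real_arch_simple of_nat_mono)
  have "?f integrable_on {1..real N}"
    using has_integral_frac_powr[OF s0 s(2) N(2)] by blast
  then have "?f integrable_on {max a c..d}"
    by (rule integrable_subinterval_real) (use a N in auto)
  then have "(\<lambda>x. if x \<in> {max a c..d} then ?f x else 0) integrable_on UNIV"
    by (simp only: integrable_restrict_UNIV)
  moreover have "(\<lambda>x. if x \<in> {max a c..d} then ?f x else 0)
      = (\<lambda>x. if x \<in> {c..d} then (if x \<in> {a..} then ?f x else 0) else 0)" by auto
  ultimately have "(\<lambda>x. if x \<in> {a..} then ?f x else 0) integrable_on {c..d}"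
    by (simp only: integrable_restrict_UNIV)
  then show "(\<lambda>x. if x \<in> {a..} then ?f x else 0) integrable_on cbox c d" by simp
qed

definition zeta_cont :: "complex \<Rightarrow> complex" where
  "zeta_cont s = s / (s - 1) - s * integral {1..} (\<lambda>x::real. of_real (frac x) * of_real x powr (- s - 1))"

text \<open>The error is exactly -s times the integral of frac x * x^(-s-1) over [N, \<infinity>),
  by subtracting the closed form on [1, N].\<close>

lemma zeta_cont_approx:
  assumes s: "0 < Re s" "s \<noteq> 1" and N: "1 \<le> N"
  shows "norm (zeta_cont s - zeta_partial N s) \<le> norm s * (real N powr (- Re s) / Re s)"
proof -
  let ?f = "\<lambda>x. of_real (frac x) * complex_of_real x powr (- s - 1)"
  have s0: "s \<noteq> 0" using s by auto
  have U: "{1..} = {1..real N} \<union> {real N..}" using N by auto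
  have int: "?f integrable_on {1..real N}" "integral {1..real N} ?f = (s / (s - 1) - zeta_partial N s) / s"
    using has_integral_frac_powr[OF s0 s(2) N] by blast+
  have intN: "?f integrable_on {real N..}" using N s by (intro frac_powr_integrable) auto
  have "integral {1..} ?f = integral {1..real N} ?f + integral {real N..} ?f"
    unfolding U by (rule integral_Un[OF int(1) intN]) (use N in \<open>simp add: Int_atLeastAtMostR2\<close>)
  then have "zeta_cont s - zeta_partial N s = - (s * integral {real N..} ?f)"
    unfolding zeta_cont_def int(2) using s0 by (simp add: field_simps)
  then have "norm (zeta_cont s - zeta_partial N s) = norm s * norm (integral {real N..} ?f)"
    by (simp add: norm_mult)
  also have "norm (integral {real N..} ?f) \<le> real N powr (- Re s) / Re s"
  proof -
    have hi: "((\<lambda>x. x powr (- Re s - 1)) has_integral real N powr (- Re s) / Re s) {real N..}"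
      using has_integral_powr_to_inf[of "- Re s - 1" "real N"] s N by simp
    have "norm (integral {real N..} ?f) \<le> integral {real N..} (\<lambda>x. x powr (- Re s - 1))"
      using hi N by (intro integral_norm_bound_integral intN norm_frac_powr_le) auto
    then show ?thesis using hi by (simp add: integral_unique)
  qed
  finally show ?thesis by (simp add: mult_left_mono)
qed

lemma zeta_partial_tendsto:
  assumes s: "0 < Re s" "s \<noteq> 1"
  shows "(\<lambda>N. zeta_partial N s) \<longlonglongrightarrow> zeta_cont s"
proof (rule Lim_null_comparison[THEN LIM_zero_cancel])
  show "eventually (\<lambda>N. norm (zeta_partial N s - zeta_cont s) \<le> norm s * (real N powr (- Re s) / Re s)) sequentially"
    using eventually_ge_at_top[of 1]
    by eventually_elim (use zeta_cont_approx[OF s] in \<open>simp add: norm_minus_commute\<close>)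
  have "(\<lambda>N. real N powr (- Re s)) \<longlonglongrightarrow> 0"
    using s by (intro tendsto_neg_powr filterlim_real_sequentially) auto
  then have "(\<lambda>N. norm s * (real N powr (- Re s) / Re s)) \<longlonglongrightarrow> norm s * (0 / Re s)"
    using s by (intro tendsto_intros) auto
  then show "(\<lambda>N. norm s * (real N powr (- Re s) / Re s)) \<longlonglongrightarrow> 0" by simp
qed

text \<open>The truncated integral may lie right of Re s = 1 while the estimates end on the critical
  line, so the two branches of \<open>zeta\<close> must be one function. For Re s > 1 the term
  N^(1-s) tends to 0 and the partial sums decide.\<close>

lemma zeta_eq_zeta_cont:
  assumes s: "0 < Re s" "s \<noteq> 1"
  shows "zeta s = zeta_cont s"
proof (cases "1 < Re s")
  case False
  then show ?thesis by (simp add: zeta_def zeta_cont_def)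
next
  case True
  have "(\<lambda>N. complex_of_nat N powr (1 - s)) \<longlonglongrightarrow> 0"
  proof (rule tendsto_norm_zero_cancel)
    have "(\<lambda>N. real N powr (1 - Re s)) \<longlonglongrightarrow> 0"
      using True by (intro tendsto_neg_powr filterlim_real_sequentially) auto
    then show "(\<lambda>N. norm (complex_of_nat N powr (1 - s))) \<longlonglongrightarrow> 0"
      by (simp add: norm_powr_real_powr)
  qed
  then have "(\<lambda>N. complex_of_nat N powr (1 - s) / (s - 1)) \<longlonglongrightarrow> 0 / (s - 1)"
    using s by (intro tendsto_divide tendsto_const) auto
  then have "(\<lambda>N. zeta_partial N s - complex_of_nat N powr (1 - s) / (s - 1)) \<longlonglongrightarrow> zeta_cont s - 0 / (s - 1)"
    by (intro tendsto_diff zeta_partial_tendsto s)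
  also have "(\<lambda>N. zeta_partial N s - complex_of_nat N powr (1 - s) / (s - 1)) = (\<lambda>N. \<Sum>n<N. 1 / of_nat (Suc n) powr s)"
  proof
    fix N
    have "(\<Sum>n=1..N. complex_of_nat n powr (- s)) = (\<Sum>n<N. complex_of_nat (Suc n) powr (- s))"
      using sum.shift_bounds_Suc_ivl[of "\<lambda>n. complex_of_nat n powr (- s)" 0 N]
      by (simp add: atLeastLessThanSuc_atLeastAtMost atLeast0LessThan)
    then show "zeta_partial N s - complex_of_nat N powr (1 - s) / (s - 1) = (\<Sum>n<N. 1 / of_nat (Suc n) powr s)"
      by (simp add: zeta_partial_def powr_minus divide_inverse del: of_nat_Suc)
  qed
  finally have "(\<lambda>n. 1 / of_nat (Suc n) powr s) sums zeta_cont s" by (simp add: sums_def)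
  then show ?thesis using True by (simp add: zeta_def sums_unique[symmetric] del: of_nat_Suc)
qed

theorem zeta_approx:
  assumes "0 < Re s" "s \<noteq> 1" "1 \<le> N"
  shows "norm (zeta s - zeta_partial N s) \<le> norm s * (real N powr (- Re s) / Re s)"
  using zeta_cont_approx[OF assms] zeta_eq_zeta_cont[OF assms(1,2)] by simp

text \<open>The approximation with N = 1. Linear growth suffices wherever the kernel is
  exponentially small; the distance 1/4 from the pole is what the line Im x = -1/4, that is Re s =
  3/4, guarantees.\<close>

lemma norm_zeta_le:
  assumes "1/2 \<le> Re s" "1/4 \<le> norm (s - 1)"
  shows "norm (zeta s) \<le> 5 + 2 * norm s"
proof -
  have s: "0 < Re s" "s \<noteq> 1" using assms by auto
  have "norm (zeta s - zeta_partial 1 s) \<le> norm s * (1 / Re s)"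
    using zeta_approx[OF s, of 1] by simp
  also have "1 / Re s \<le> 2" using assms by (simp add: field_simps)
  finally have 1: "norm (zeta s - zeta_partial 1 s) \<le> norm s * 2" by (simp add: mult_left_mono)
  have "norm (zeta_partial 1 s) \<le> 1 + norm (1 / (s - 1))"
    unfolding zeta_partial_def by (rule order_trans[OF norm_triangle_ineq]) simp
  also have "norm (1 / (s - 1)) \<le> 1 / (1/4)" unfolding norm_divide using assms by (intro frac_le) auto
  finally show ?thesis using 1 norm_triangle_ineq2[of "zeta s" "zeta_partial 1 s"] by simp
qed

text \<open>The entire sums of powers with their tail terms converge locally uniformly away from the
  pole. On a closed disc the error is uniform because Re attains a positive minimum \<open>c\<close>
  there.\<close>

theorem zeta_holomorphic: "zeta holomorphic_on {s. 0 < Re s} - {1}"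
proof -
  let ?S = "{s. 0 < Re s} - {1::complex}"
  have op: "open ?S" by (intro open_Diff open_halfspace_Re_gt) auto
  have "zeta_cont holomorphic_on ?S"
  proof (rule holomorphic_uniform_sequence[OF op])
    show "zeta_partial (Suc n) holomorphic_on ?S" for n
      unfolding zeta_partial_def
      by (intro holomorphic_intros) auto
    fix z assume z: "z \<in> ?S"
    obtain d where d: "d > 0" "cball z d \<subseteq> ?S" using op z open_contains_cball by blast
    obtain w where w: "w \<in> cball z d" "\<And>y. y \<in> cball z d \<Longrightarrow> Re w \<le> Re y"
      using continuous_attains_inf[of "cball z d" Re] d continuous_on_Re[OF continuous_on_id, of "cball z d"]
      by auto
    define c where "c = Re w"
    have c: "c > 0" "\<And>y. y \<in> cball z d \<Longrightarrow> c \<le> Re y" using w d unfolding c_def by auto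
    define B where "B = norm z + d"
    have B: "norm y \<le> B" if "y \<in> cball z d" for y
      using that norm_triangle_ineq2[of y z] by (auto simp: B_def dist_norm norm_minus_commute)
    have lim: "(\<lambda>n. B * (real (Suc n) powr (- c) / c)) \<longlonglongrightarrow> 0"
    proof -
      have "(\<lambda>N. real (Suc N) powr (- c)) \<longlonglongrightarrow> 0"
        using c by (intro tendsto_neg_powr filterlim_compose[OF filterlim_real_sequentially filterlim_Suc]) auto
      then have "(\<lambda>n. B * (real (Suc n) powr (- c) / c)) \<longlonglongrightarrow> B * (0 / c)"
        using c by (intro tendsto_intros) auto
      then show ?thesis by simp
    qed
    have bd: "norm (zeta_partial (Suc n) y - zeta_cont y) \<le> B * (real (Suc n) powr (- c) / c)" if "y \<in> cball z d" for n y
    proof -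
      have y: "0 < Re y" "y \<noteq> 1" using that d by auto
      have "norm (zeta_partial (Suc n) y - zeta_cont y) \<le> norm y * (real (Suc n) powr (- Re y) / Re y)"
        using zeta_cont_approx[OF y, of "Suc n"] by (simp add: norm_minus_commute)
      also have "\<dots> \<le> B * (real (Suc n) powr (- c) / c)"
        using c(1) c(2)[OF that] B[OF that] y by (intro mult_mono frac_le powr_mono) (auto intro: order_trans[OF norm_ge_zero])
      finally show ?thesis .
    qed
    have "uniform_limit (cball z d) (\<lambda>n. zeta_partial (Suc n)) zeta_cont sequentially"
    proof (rule uniform_limitI)
      fix e :: real assume "e > 0"
      then have "eventually (\<lambda>n. B * (real (Suc n) powr (- c) / c) < e) sequentially"
        using order_tendstoD(2)[OF lim] by blast
      then show "eventually (\<lambda>n. \<forall>x\<in>cball z d. dist (zeta_partial (Suc n) x) (zeta_cont x) < e) sequentially"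
        by eventually_elim (unfold dist_norm, blast intro: le_less_trans bd)
    qed
    then show "\<exists>d>0. cball z d \<subseteq> ?S \<and> uniform_limit (cball z d) (\<lambda>n. zeta_partial (Suc n)) zeta_cont sequentially"
      using d by blast
  qed
  then show ?thesis
    by (rule holomorphic_transform) (use zeta_eq_zeta_cont in auto)
qed

section \<open>Weyl's bound on the critical line\<close>

text \<open>Abel summation: decreasing nonnegative weights cost no more than the first weight times
  a bound for all initial sums.\<close>

lemma norm_weighted_sum_le:
  fixes w :: "nat \<Rightarrow> real" and z :: "nat \<Rightarrow> complex"
  assumes dec: "\<And>n. a \<le> n \<Longrightarrow> w (Suc n) \<le> w n" and nn: "\<And>n. 0 \<le> w n"
    and S: "\<And>c. a \<le> c \<Longrightarrow> c \<le> b \<Longrightarrow> norm (\<Sum>n=a..<c. z n) \<le> B" and ab: "a \<le> b"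
  shows "norm (\<Sum>n=a..<b. of_real (w n) * z n) \<le> w a * B"
proof -
  define P where "P = (\<lambda>c. \<Sum>n=a..<c. z n)"
  have "norm ((\<Sum>n=a..<c. of_real (w n) * z n) - of_real (w c) * P c) \<le> (w a - w c) * B"
    if "a \<le> c" "c \<le> b" for c
    using that
  proof (induction c rule: dec_induct)
    case base then show ?case by (simp add: P_def)
  next
    case (step c)
    have "(\<Sum>n=a..<Suc c. of_real (w n) * z n) - of_real (w (Suc c)) * P (Suc c)
      = ((\<Sum>n=a..<c. of_real (w n) * z n) - of_real (w c) * P c) + of_real (w c - w (Suc c)) * P (Suc c)"
      using step.hyps by (simp add: P_def algebra_simps)
    also have "norm \<dots> \<le> (w a - w c) * B + (w c - w (Suc c)) * B"
    proof (intro order_trans[OF norm_triangle_ineq] add_mono)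
      show "norm ((\<Sum>n=a..<c. of_real (w n) * z n) - of_real (w c) * P c) \<le> (w a - w c) * B"
        using step by simp
      have "norm (complex_of_real (w c - w (Suc c)) * P (Suc c)) = (w c - w (Suc c)) * norm (P (Suc c))"
        using dec[of c] step.hyps by (simp only: norm_mult norm_of_real) simp
      also have "\<dots> \<le> (w c - w (Suc c)) * B"
        using dec[of c] step.hyps S[of "Suc c"] step.prems by (intro mult_left_mono) (auto simp: P_def)
      finally show "norm (complex_of_real (w c - w (Suc c)) * P (Suc c)) \<le> (w c - w (Suc c)) * B" .
    qed
    finally show ?case by (simp add: algebra_simps)
  qed
  from this[OF ab order_refl] have 1: "norm ((\<Sum>n=a..<b. of_real (w n) * z n) - of_real (w b) * P b) \<le> (w a - w b) * B" .
  have "norm (complex_of_real (w b) * P b) \<le> w b * B"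
    using S[OF ab order_refl] nn[of b] by (simp add: norm_mult P_def mult_left_mono)
  then show ?thesis
    using 1 norm_triangle_ineq2[of "\<Sum>n=a..<b. of_real (w n) * z n" "of_real (w b) * P b"]
    by (simp add: algebra_simps)
qed

lemma of_nat_powr_critical:
  assumes "1 \<le> n"
  shows "complex_of_nat n powr (- (1/2 + \<i> * of_real t)) = of_real (1 / sqrt (real n)) * cis (- t * ln (real n))"
proof -
  have "complex_of_nat n powr (- (1/2 + \<i> * of_real t)) = exp (of_real (- (ln (real n) / 2)) + \<i> * of_real (- t * ln (real n)))"
  proof -
    have "- (1/2 + \<i> * complex_of_real t) * of_real (ln (real n)) = of_real (- (ln (real n) / 2)) + \<i> * of_real (- t * ln (real n))"
      by (simp add: algebra_simps)
    then show ?thesis using assms by (simp only: powr_def Ln_of_nat) (simp add: Ln_of_nat)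
  qed
  also have "\<dots> = of_real (exp (- (ln (real n) / 2))) * cis (- t * ln (real n))"
    unfolding exp_add cis_conv_exp exp_of_real ..
  also have "exp (- (ln (real n) / 2)) = 1 / sqrt (real n)"
  proof -
    have "exp (- (ln (real n) / 2)) = inverse (exp (ln (sqrt (real n))))"
      using assms by (simp add: ln_sqrt exp_minus)
    also have "\<dots> = 1 / sqrt (real n)" using assms by (simp add: divide_inverse)
    finally show ?thesis .
  qed
  finally show ?thesis .
qed

text \<open>The weights n^(-1/2) are at most M^(-1/2) and cancel the factor sqrt(M) of the block
  bound. For M > t this needs M/t <= sqrt(M), hence the restriction M <= t^2.\<close>

lemma zeta_block_bound:
  fixes M :: nat
  assumes q: "1 \<le> q" and M: "1 \<le> M" "real M \<le> (q ^ 6) ^ 2"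
  shows "norm (\<Sum>n=M..<2*M. complex_of_nat n powr (- (1/2 + \<i> * of_real (q ^ 6)))) \<le> 102 * q"
proof -
  let ?t = "q ^ 6"
  define B where "B = 102 * (sqrt (real M) * q)"
  have t1: "1 \<le> ?t" using q by simp
  have part: "norm (\<Sum>n=M..<c. cis (- ?t * ln (real n))) \<le> B" if "c \<le> 2 * M" for c
  proof (cases "real M \<le> ?t")
    case True
    then show ?thesis unfolding B_def using log_sum_weyl_bound[OF q M(1) order_refl that True] by simp
  next
    case False
    have "norm (\<Sum>n=M..<c. cis (- ?t * ln (real n))) \<le> 40 * (real M / ?t)"
      by (rule log_sum_long_bound) (use False t1 M that in auto)
    also have "real M / ?t = sqrt (real M) * (sqrt (real M) / ?t)" by simp
    also have "\<dots> \<le> sqrt (real M) * 1"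
    proof (rule mult_left_mono)
      have "sqrt (real M) \<le> ?t" by (rule real_le_lsqrt) (use M t1 in auto)
      moreover have "0 < ?t" using t1 by linarith
      ultimately show "sqrt (real M) / ?t \<le> 1" by (simp only: divide_le_eq_1_pos)
    qed simp
    also have "sqrt (real M) * 1 \<le> sqrt (real M) * q" using q by (intro mult_left_mono) auto
    finally have "norm (\<Sum>n=M..<c. cis (- ?t * ln (real n))) \<le> 40 * (sqrt (real M) * q)" by simp
    moreover have "0 \<le> sqrt (real M) * q" using q by simp
    ultimately show ?thesis unfolding B_def by linarith
  qed
  have "(\<Sum>n=M..<2*M. complex_of_nat n powr (- (1/2 + \<i> * of_real ?t)))
      = (\<Sum>n=M..<2*M. of_real (1 / sqrt (real n)) * cis (- ?t * ln (real n)))"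
    using M by (intro sum.cong of_nat_powr_critical) auto
  also have "norm \<dots> \<le> 1 / sqrt (real M) * B"
    by (rule norm_weighted_sum_le) (use M part in \<open>auto intro!: divide_left_mono mult_pos_pos\<close>)
  also have "\<dots> = 102 * q" using M by (simp add: B_def)
  finally show ?thesis .
qed

lemma sum_dyadic:
  fixes f :: "nat \<Rightarrow> 'a::comm_monoid_add"
  shows "(\<Sum>n=1..<2^J. f n) = (\<Sum>j<J. \<Sum>n=2^j..<2*2^j. f n)"
proof (induction J)
  case (Suc J)
  have "{1..<2 ^ Suc J} = {1..<2 ^ J} \<union> {2 ^ J..<2 * 2 ^ J::nat}"
    using one_le_power[of "2::nat" J] by auto
  then have "(\<Sum>n=1..<2^Suc J. f n) = (\<Sum>n=1..<2^J. f n) + (\<Sum>n=2^J..<2*2^J. f n)"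
    by (simp only:) (subst sum.union_disjoint; auto)
  then show ?case using Suc by simp
qed simp

text \<open>The remainder in \<open>zeta_approx\<close> is of order t / sqrt(N), so the sum has to
  run to N of order t^2; this is why blocks longer than t occur. A power of two N = 2^J cuts the sum
  into O(log t) dyadic blocks, each bounded by 102 q.\<close>

lemma zeta_weyl_aux:
  assumes q: "1 \<le> q"
  defines "t \<equiv> q ^ 6"
  shows "norm (zeta (1/2 + \<i> * of_real t)) \<le> 400 * q * (1 + ln t)"
proof -
  have t1: "1 \<le> t" using q by (simp add: t_def)
  let ?s = "1/2 + \<i> * complex_of_real t"
  define J where "J = nat \<lceil>log 2 (t ^ 2)\<rceil>"
  have l0: "0 \<le> log 2 (t ^ 2)" using t1 by simp
  have J1: "t ^ 2 \<le> 2 ^ J"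
  proof -
    have "log 2 (t ^ 2) \<le> real J" unfolding J_def using l0 by linarith
    then show ?thesis using t1 by (simp add: log_le_iff powr_realpow)
  qed
  have Jlt: "real J < log 2 (t ^ 2) + 1" unfolding J_def using l0 by linarith
  have J2: "2 ^ J \<le> 2 * t ^ 2"
  proof -
    have "2 powr real J \<le> 2 powr (log 2 (t ^ 2) + 1)" using Jlt by (intro powr_mono) auto
    also have "\<dots> = 2 * t ^ 2" using t1 by (subst powr_add) simp
    finally show ?thesis by (simp add: powr_realpow)
  qed
  have Jb: "real J \<le> 1 + 3 * ln t"
  proof -
    have "log 2 (t ^ 2) = 2 * ln t / ln 2" using t1 by (simp add: log_def ln_realpow)
    also have "\<dots> \<le> 2 * ln t / (2 / 3)" using ln2_ge_two_thirds t1 by (intro divide_left_mono) auto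
    finally show ?thesis using Jlt by simp
  qed
  define N :: nat where "N = 2 ^ J"
  have N1: "1 \<le> N" by (simp add: N_def)
  have sN: "t \<le> sqrt (real N)" "sqrt (real N) \<le> 2 * t"
  proof -
    show "t \<le> sqrt (real N)" using J1 by (intro real_le_rsqrt) (simp add: N_def)
    have "real N \<le> 2 * t ^ 2" using J2 by (simp add: N_def)
    also have "\<dots> \<le> (2 * t) ^ 2" by (simp add: power_mult_distrib)
    finally show "sqrt (real N) \<le> 2 * t" using t1 by (intro real_le_lsqrt) auto
  qed
  have "norm (\<Sum>n=1..<N. complex_of_nat n powr (- ?s)) \<le> (\<Sum>j<J. 102 * q)"
    unfolding N_def sum_dyadic
  proof (rule order_trans[OF norm_sum], rule sum_mono)
    fix j assume "j \<in> {..<J}"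
    then have "j \<le> J - 1" "0 < J" by auto
    \<comment> \<open>The last block starts at 2^(J-1), which is still at most t^2 although N itself
      may exceed it.\<close>
    then have "real j \<le> real J - 1" by linarith
    then have "2 powr real j \<le> 2 powr (log 2 (t ^ 2))" using Jlt by (intro powr_mono) auto
    then have "2 ^ j \<le> t ^ 2" using t1 by (simp add: powr_realpow)
    then show "norm (\<Sum>n=2^j..<2*2^j. complex_of_nat n powr (- ?s)) \<le> 102 * q"
      unfolding t_def by (intro zeta_block_bound q) auto
  qed
  also have "\<dots> \<le> (1 + 3 * ln t) * (102 * q)" using Jb q by (simp add: mult_right_mono)
  finally have 1: "norm (\<Sum>n=1..<N. complex_of_nat n powr (- ?s)) \<le> (1 + 3 * ln t) * (102 * q)" .
  have 2: "norm (complex_of_nat N powr (- ?s)) \<le> 1"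
    using N1 sN(1) t1 by (subst of_nat_powr_critical) (auto simp: norm_mult norm_divide)
  have nN: "norm (complex_of_nat N powr (1 - ?s)) = sqrt (real N)"
    using N1 by (simp add: norm_powr_real_powr powr_half_sqrt)
  have 3: "norm (complex_of_nat N powr (1 - ?s) / (?s - 1)) \<le> 2"
  proof -
    have "t \<le> norm (?s - 1)" using abs_Im_le_cmod[of "?s - 1"] t1 by simp
    then have "sqrt (real N) / norm (?s - 1) \<le> 2 * t / t" using sN t1 by (intro frac_le) auto
    then show ?thesis unfolding norm_divide nN using t1 by simp
  qed
  have nt: "?s \<noteq> 1" using t1 by (auto simp: complex_eq_iff)
  have 4: "norm (zeta ?s - zeta_partial N ?s) \<le> 3"
  proof -
    have "norm ?s \<le> 1/2 + t" using norm_triangle_ineq[of "1/2" "\<i> * complex_of_real t"] t1 by (simp add: norm_mult)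
    have "norm (zeta ?s - zeta_partial N ?s) \<le> norm ?s * (real N powr (- Re ?s) / Re ?s)"
      by (rule zeta_approx) (use nt N1 in auto)
    also have "\<dots> = norm ?s * (2 / sqrt (real N))"
      using N1 by (simp add: powr_minus_divide powr_half_sqrt)
    also have "\<dots> \<le> (1/2 + t) * (2 / t)"
      using \<open>norm ?s \<le> 1/2 + t\<close> sN t1 by (intro mult_mono frac_le) auto
    also have "\<dots> \<le> 3" using t1 by (simp add: field_simps)
    finally show ?thesis .
  qed
  have "{1..N} = insert N {1..<N}" using N1 by auto
  then have "zeta_partial N ?s = (\<Sum>n=1..<N. complex_of_nat n powr (- ?s)) + complex_of_nat N powr (- ?s)
       + complex_of_nat N powr (1 - ?s) / (?s - 1)"
    by (simp add: zeta_partial_def)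
  then have "norm (zeta_partial N ?s) \<le> (1 + 3 * ln t) * (102 * q) + 1 + 2"
    using order_trans[OF norm_triangle_ineq add_mono[OF order_trans[OF norm_triangle_ineq add_mono[OF 1 2]] 3]]
    by simp
  then have "norm (zeta ?s) \<le> (1 + 3 * ln t) * (102 * q) + 6"
    using 4 norm_triangle_ineq2[of "zeta ?s" "zeta_partial N ?s"] by simp
  also have "\<dots> \<le> 400 * q * (1 + ln t)"
  proof -
    have "0 \<le> q * ln t" using q t1 by simp
    then show ?thesis using q by (simp add: algebra_simps)
  qed
  finally show ?thesis .
qed

theorem zeta_weyl_bound:
  assumes "1 \<le> t"
  shows "norm (zeta (1/2 + \<i> * of_real t)) \<le> 400 * t powr (1/6) * (1 + ln t)"
proof -
  have "(t powr (1/6)) ^ 6 = t" using assms by (simp add: powr_power)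
  moreover have "1 \<le> t powr (1/6)" using assms by (simp add: ge_one_powr_ge_zero)
  ultimately show ?thesis using zeta_weyl_aux[of "t powr (1/6)"] by simp
qed

section \<open>The digamma function and the Riemann--Siegel theta function\<close>

lemma cmod_le_cmod_add_real:
  assumes "0 \<le> Re w" "0 \<le> u"
  shows "norm w \<le> norm (w + of_real u)"
proof -
  have "(Re w)\<^sup>2 \<le> (Re w + u)\<^sup>2" using assms by (intro power_mono) auto
  then show ?thesis unfolding cmod_def by (intro real_sqrt_le_mono) simp
qed

text \<open>The function Ln z - z/w has derivative 1/z - 1/w, which at z = w + u equals -u / (z w);
  moving right from \<open>w\<close> does not decrease the modulus.\<close>

lemma Ln_unit_step:
  assumes "0 < Re w"
  shows "norm (Ln (w + 1) - Ln w - inverse w) \<le> 1 / (norm w)\<^sup>2"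
proof -
  have w0: "w \<noteq> 0" using assms by auto
  define f where "f = (\<lambda>z. Ln z - z / w)"
  have seg: "\<exists>u. z = w + of_real u \<and> 0 \<le> u \<and> u \<le> 1" if "z \<in> closed_segment w (w + 1)" for z
    using that by (auto simp: in_segment scaleR_conv_of_real algebra_simps)
  have "norm (f (w + 1) - f w) \<le> 1 / (norm w)\<^sup>2 * norm ((w + 1) - w)"
  proof (rule field_differentiable_bound[where S = "closed_segment w (w + 1)" and f' = "\<lambda>z. inverse z - 1 / w"])
    fix z assume "z \<in> closed_segment w (w + 1)"
    then obtain u where u: "z = w + of_real u" "0 \<le> u" "u \<le> 1" using seg by blast
    have z: "0 < Re z" using u assms by simp
    then have z0: "z \<noteq> 0" by auto
    from z have "z \<notin> \<real>\<^sub>\<le>\<^sub>0" by (auto simp: complex_nonpos_Reals_iff)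
    then show "(f has_field_derivative inverse z - 1 / w) (at z within closed_segment w (w + 1))"
      unfolding f_def by (auto intro!: derivative_eq_intros simp: divide_inverse)
    have "inverse z - 1 / w = - of_real u / (z * w)"
      using z0 w0 u(1) by (simp add: field_simps)
    then have "norm (inverse z - 1 / w) = u / (norm z * norm w)"
      using u by (simp add: norm_mult norm_divide)
    also have "\<dots> \<le> 1 / (norm w * norm w)"
      using u w0 assms cmod_le_cmod_add_real[of w u] by (intro frac_le mult_right_mono) auto
    finally show "norm (inverse z - 1 / w) \<le> 1 / (norm w)\<^sup>2" by (simp add: power2_eq_square)
  qed auto
  moreover have "f (w + 1) - f w = Ln (w + 1) - Ln w - inverse w"
    using w0 by (simp add: f_def field_simps)
  ultimately show ?thesis by simp
qed

text \<open>Replace |z + n| by r + n with r = Re z + |Im z|, at the cost of a factor 2 from (a +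
  b)^2 <= 2 (a^2 + b^2); the sum of (r + n)^(-2) is then bounded by a telescoping sum.\<close>

lemma sum_inverse_cmod_square_le:
  assumes z: "0 < Re z"
  shows "(\<Sum>n<m. 1 / (norm (z + of_nat n))\<^sup>2) \<le> 2 / (norm z)\<^sup>2 + 2 / norm z"
proof -
  define r where "r = Re z + \<bar>Im z\<bar>"
  have r: "0 < r" "norm z \<le> r" using z cmod_le[of z] by (auto simp: r_def)
  have nz: "0 < norm z" using z by auto
  have summand: "1 / (norm (z + of_nat n))\<^sup>2 \<le> 2 / (r + real n)\<^sup>2" for n
  proof -
    have "(r + real n)\<^sup>2 \<le> 2 * (norm (z + of_nat n))\<^sup>2"
    proof -
      have "(norm (z + of_nat n))\<^sup>2 = (Re z + real n)\<^sup>2 + \<bar>Im z\<bar>\<^sup>2" by (simp add: cmod_power2)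
      moreover have "(r + real n)\<^sup>2 = (Re z + real n + \<bar>Im z\<bar>)\<^sup>2" by (simp add: r_def add_ac)
      ultimately show ?thesis
        using sum_squares_bound[of "Re z + real n" "\<bar>Im z\<bar>"] power2_sum[of "Re z + real n" "\<bar>Im z\<bar>"]
        by linarith
    qed
    moreover have "0 < (r + real n)\<^sup>2" using r by (intro zero_less_power) auto
    ultimately show ?thesis using z by (auto simp: divide_simps)
  qed
  have "(\<Sum>n<Suc m. 2 / (r + real n)\<^sup>2) \<le> 2 / r\<^sup>2 + 2 / r - 2 / (r + real m)" for m
  proof (induction m)
    case (Suc m)
    have p: "0 < r + real m" using r by simp
    have "2 / (r + real (Suc m))\<^sup>2 \<le> 2 / ((r + real m) * (r + real (Suc m)))"
      using p by (intro divide_left_mono) (auto simp: power2_eq_square intro!: mult_right_mono)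
    also have "\<dots> = 2 / (r + real m) - 2 / (r + real (Suc m))"
      using p by (simp add: field_simps)
    finally show ?case using Suc by simp
  qed simp
  moreover have "2 / (r + real m) \<ge> 0" for m using r by simp
  ultimately have S: "(\<Sum>n<Suc m. 2 / (r + real n)\<^sup>2) \<le> 2 / r\<^sup>2 + 2 / r" for m
    by (smt (verit, best))
  have "(\<Sum>n<m. 1 / (norm (z + of_nat n))\<^sup>2) \<le> (\<Sum>n<Suc m. 2 / (r + real n)\<^sup>2)"
    using sum_mono[of "{..<m}", OF summand] r by (simp add: add_increasing2)
  also note S
  also have "2 / r\<^sup>2 + 2 / r \<le> 2 / (norm z)\<^sup>2 + 2 / norm z"
    using r nz by (intro add_mono frac_le power_mono) auto
  finally show ?thesis .
qed

text \<open>Takes the place of Stirling's formula. In the limit formula for \<open>Digamma\<close>,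
  ln m may be replaced by Ln(z + m), since they differ by Ln(1 + z/m); then Ln(z + m) - Ln z
  telescopes into unit steps, each compared with 1/(z + n).\<close>

theorem Digamma_approx_Ln:
  assumes z: "0 < Re z"
  shows "norm (Digamma z - Ln z) \<le> 2 / (norm z)\<^sup>2 + 2 / norm z"
proof -
  have z0: "z \<noteq> 0" using z by auto
  define D where "D = (\<lambda>m. complex_of_real (ln (real m)) - (\<Sum>n<m. inverse (z + of_nat n)))"
  have D: "D \<longlonglongrightarrow> Digamma z" unfolding D_def by (rule Digamma_LIMSEQ[OF z0])
  define E where "E = (\<lambda>m. Ln (z + of_nat m) - Ln z - (\<Sum>n<m. inverse (z + of_nat n)))"
  have Eb: "norm (E m) \<le> 2 / (norm z)\<^sup>2 + 2 / norm z" for m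
  proof -
    have "E m = (\<Sum>n<m. Ln (z + of_nat n + 1) - Ln (z + of_nat n) - inverse (z + of_nat n))"
      unfolding E_def by (induction m) (simp_all add: algebra_simps)
    also have "norm \<dots> \<le> (\<Sum>n<m. 1 / (norm (z + of_nat n))\<^sup>2)"
      by (rule order_trans[OF norm_sum]) (use z in \<open>auto intro!: sum_mono Ln_unit_step\<close>)
    finally show ?thesis using sum_inverse_cmod_square_le[OF z, of m] by linarith
  qed
  have "(\<lambda>m. Ln (1 + z / of_nat m)) \<longlonglongrightarrow> Ln (1 + 0)"
    by (intro tendsto_Ln tendsto_add tendsto_const lim_const_over_n) auto
  then have L: "(\<lambda>m. Ln (1 + z / of_nat m)) \<longlonglongrightarrow> 0" by simp
  have "eventually (\<lambda>m. D m - Ln z + Ln (1 + z / of_nat m) = E m) sequentially"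
    using eventually_gt_at_top[of 0]
  proof eventually_elim
    case (elim m)
    have "z + of_nat m = complex_of_real (real m) * (1 + z / of_nat m)" using elim by (simp add: field_simps)
    moreover have "1 + z / of_nat m \<noteq> 0"
    proof
      assume "1 + z / of_nat m = 0"
      then have "Re (1 + z / of_nat m) = 0" by simp
      then show False using z elim by (simp add: Re_divide_of_nat) (smt (verit) divide_pos_pos of_nat_0_less_iff)
    qed
    ultimately have "Ln (z + of_nat m) = of_real (ln (real m)) + Ln (1 + z / of_nat m)"
      using elim Ln_times_of_real[of "real m" "1 + z / of_nat m"] by simp
    then show ?case by (simp add: D_def E_def)
  qed
  moreover have "(\<lambda>m. D m - Ln z + Ln (1 + z / of_nat m)) \<longlonglongrightarrow> Digamma z - Ln z + 0"
    by (intro tendsto_intros D L)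
  ultimately have "E \<longlonglongrightarrow> Digamma z - Ln z"
    using Lim_transform_eventually by force
  then show ?thesis
    by (rule Lim_norm_ubound[rotated]) (use Eb in auto)
qed

text \<open>Serves to show that theta is real on the real axis. Re z > 0 keeps the arguments of the
  logarithms in the defining series off the branch cut, so conjugation passes through each
  term.\<close>

lemma cnj_ln_Gamma:
  assumes "0 < Re z"
  shows "ln_Gamma (cnj z) = cnj (ln_Gamma z)"
proof -
  have nz: "z \<notin> \<int>\<^sub>\<le>\<^sub>0" "cnj z \<notin> \<int>\<^sub>\<le>\<^sub>0" using assms by (auto elim!: nonpos_Ints_cases simp: complex_eq_iff)
  have "cnj (ln_Gamma_series z n) = ln_Gamma_series (cnj z) n" if "0 < n" for n
  proof -
    have 1: "cnj (Ln z) = Ln (cnj z)" using assms by (intro cnj_Ln) (auto simp: complex_nonpos_Reals_iff)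
    have 2: "cnj (Ln (z / of_nat k + 1)) = Ln (cnj z / of_nat k + 1)" for k
    proof -
      have "0 \<le> Re z / real k" using assms by simp
      then have "cnj (Ln (z / of_nat k + 1)) = Ln (cnj (z / of_nat k + 1))"
        by (intro cnj_Ln) (auto simp: complex_nonpos_Reals_iff)
      then show ?thesis by simp
    qed
    have 3: "cnj (Ln (of_nat n)) = Ln (of_nat n)"
      using that by (simp add: Ln_of_nat)
    show ?thesis by (simp add: ln_Gamma_series_def 1 2 3)
  qed
  then have "eventually (\<lambda>n. cnj (ln_Gamma_series z n) = ln_Gamma_series (cnj z) n) sequentially"
    by (rule eventually_mono[OF eventually_gt_at_top[of 0]])
  moreover have "(\<lambda>n. cnj (ln_Gamma_series z n)) \<longlonglongrightarrow> cnj (ln_Gamma z)"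
    by (intro tendsto_cnj ln_Gamma_complex_LIMSEQ nz)
  ultimately have "ln_Gamma_series (cnj z) \<longlonglongrightarrow> cnj (ln_Gamma z)"
    by (rule Lim_transform_eventually[rotated])
  moreover have "ln_Gamma_series (cnj z) \<longlonglongrightarrow> ln_Gamma (cnj z)"
    by (intro ln_Gamma_complex_LIMSEQ nz)
  ultimately show ?thesis using LIMSEQ_unique by blast
qed

section \<open>The theta function on and below the real axis\<close>

lemma Im_rs_theta_real: "Im (rs_theta (of_real t)) = 0"
proof -
  have "ln_Gamma (1/4 - \<i> * of_real t / 2) = cnj (ln_Gamma (1/4 + \<i> * of_real t / 2))"
    using cnj_ln_Gamma[of "1/4 + \<i> * of_real t / 2"] by simp
  then have "rs_theta (of_real t) = of_real (Im (ln_Gamma (1/4 + \<i> * of_real t / 2))) - of_real (t / 2 * ln pi)"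
    unfolding rs_theta_def by (simp add: complex_diff_cnj field_simps)
  then show ?thesis by simp
qed

definition rs_theta_deriv :: "complex \<Rightarrow> complex" where
  "rs_theta_deriv z = (Digamma (1/4 + \<i> * z / 2) + Digamma (1/4 - \<i> * z / 2)) / 4 - of_real (ln pi) / 2"

lemma rs_theta_has_field_derivative:
  assumes "\<bar>Im z\<bar> < 1/2"
  shows "(rs_theta has_field_derivative rs_theta_deriv z) (at z within S)"
proof -
  have "1/4 + \<i> * z / 2 \<notin> \<real>\<^sub>\<le>\<^sub>0" "1/4 - \<i> * z / 2 \<notin> \<real>\<^sub>\<le>\<^sub>0"
    using assms by (auto simp: complex_nonpos_Reals_iff)
  then show ?thesis
    unfolding rs_theta_def rs_theta_deriv_def
    by (auto intro!: derivative_eq_intros simp: field_simps)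
qed

text \<open>The two digamma arguments are conjugate, so their logarithms add up to 2 ln |w|, and |w|
  is T/2 up to an additive 1/4.\<close>

lemma rs_theta_deriv_real_approx:
  assumes T: "1 \<le> T"
  shows "norm (rs_theta_deriv (of_real T) - of_real (ln (T / (2 * pi)) / 2)) \<le> 7 / T"
proof -
  define w where "w = 1/4 + \<i> * complex_of_real T / 2"
  have cw: "cnj w = 1/4 - \<i> * complex_of_real T / 2" by (simp add: w_def)
  have Rw: "0 < Re w" "0 < Re (cnj w)" by (auto simp: w_def)
  have n1: "T / 2 \<le> norm w" using abs_Im_le_cmod[of w] T by (simp add: w_def)
  have n2: "norm w \<le> T / 2 + 1/4" using cmod_le[of w] T by (simp add: w_def)
  have err: "2 / (norm w)\<^sup>2 + 2 / norm w \<le> 12 / T"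
  proof -
    have "2 / norm w \<le> 2 / (T / 2)" using n1 T by (intro frac_le) auto
    moreover have "2 / (norm w)\<^sup>2 \<le> 2 / (T / 2)\<^sup>2" using n1 T by (intro frac_le power_mono) auto
    moreover have "2 / (T / 2)\<^sup>2 \<le> 8 / T" using T by (simp add: divide_simps power2_eq_square)
    ultimately show ?thesis by simp
  qed
  have d1: "norm (Digamma w - Ln w) \<le> 12 / T" using Digamma_approx_Ln[OF Rw(1)] err by linarith
  have d2: "norm (Digamma (cnj w) - Ln (cnj w)) \<le> 12 / T" using Digamma_approx_Ln[OF Rw(2)] err by simp
  have "w \<noteq> 0" using Rw by auto
  have "Ln (cnj w) = cnj (Ln w)" using Rw by (subst cnj_Ln) (auto simp: complex_nonpos_Reals_iff)
  then have "Ln w + Ln (cnj w) = of_real (2 * ln (norm w))"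
    using \<open>w \<noteq> 0\<close> by (simp only: complex_add_cnj) simp
  moreover have "ln (T / (2 * pi)) = ln (T / 2) - ln pi" using T by (simp add: ln_div ln_mult)
  then have "complex_of_real (ln (T / (2 * pi))) = of_real (ln (T / 2)) - of_real (ln pi)" by simp
  ultimately have "rs_theta_deriv (of_real T) - of_real (ln (T / (2 * pi)) / 2)
     = ((Digamma w - Ln w) + (Digamma (cnj w) - Ln (cnj w))) / 4 + of_real ((ln (norm w) - ln (T / 2)) / 2)"
    unfolding rs_theta_deriv_def w_def[symmetric] cw[symmetric] of_real_divide
    by (simp add: field_simps) (metis distrib_right mult.commute)
  also have "norm \<dots> \<le> (12 / T + 12 / T) / 4 + 1 / T"
  proof (intro order_trans[OF norm_triangle_ineq] add_mono)
    show "norm (((Digamma w - Ln w) + (Digamma (cnj w) - Ln (cnj w))) / 4) \<le> (12 / T + 12 / T) / 4"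
      unfolding norm_divide using order_trans[OF norm_triangle_ineq add_mono[OF d1 d2]] by simp
    have "ln (T / 2) \<le> ln (norm w)" using n1 T by (intro ln_mono) auto
    moreover have "ln (norm w) - ln (T / 2) \<le> 1 / (2 * T)"
    proof -
      have "ln (norm w) - ln (T / 2) = ln (norm w / (T / 2))"
        using T \<open>w \<noteq> 0\<close> by (simp add: ln_div ln_mult)
      also have "\<dots> \<le> norm w / (T / 2) - 1" using T \<open>w \<noteq> 0\<close> by (intro ln_le_minus_one) auto
      also have "\<dots> \<le> (T / 2 + 1/4) / (T / 2) - 1" using n2 T by (intro diff_right_mono divide_right_mono) auto
      also have "(T / 2 + 1/4) / (T / 2) - 1 = 1 / (2 * T)" using T by (simp add: field_simps)
      finally show ?thesis .
    qed
    ultimately have "\<bar>(ln (norm w) - ln (T / 2)) / 2\<bar> \<le> 1 / (4 * T)" using T by (simp add: field_simps)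
    also have "\<dots> \<le> 1 / T" using T by (simp add: field_simps)
    finally show "norm (complex_of_real ((ln (norm w) - ln (T / 2)) / 2)) \<le> 1 / T"
      by (simp only: norm_of_real)
  qed
  finally show ?thesis using T by simp
qed

text \<open>Subtract the linear function of slope ln(t / (2 pi)) / 2. The derivative of the rest is
  the Stirling error O(1/t), giving the 1 in 1 + |u|, plus the change of the logarithm from t to T,
  giving the |u|; T >= t/2 keeps both uniform.\<close>

theorem rs_theta_increment:
  assumes t: "2 \<le> t" and u: "\<bar>u\<bar> \<le> t / 2"
  shows "norm (rs_theta (of_real (t + u)) - rs_theta (of_real t) - of_real (u / 2 * ln (t / (2 * pi))))
    \<le> 14 * \<bar>u\<bar> * (1 + \<bar>u\<bar>) / t"
proof -
  define l where "l = ln (t / (2 * pi)) / 2"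
  define f where "f = (\<lambda>z. rs_theta z - z * of_real l)"
  have "norm (f (of_real (t + u)) - f (of_real t)) \<le> 14 * (1 + \<bar>u\<bar>) / t * norm (complex_of_real (t + u) - of_real t)"
  proof (rule field_differentiable_bound[where S = "closed_segment (of_real t) (of_real (t + u))" and f' = "\<lambda>z. rs_theta_deriv z - of_real l"])
    fix z assume "z \<in> closed_segment (complex_of_real t) (of_real (t + u))"
    then obtain a where a: "0 \<le> a" "a \<le> 1" "z = of_real (t + a * u)"
      by (auto simp: in_segment scaleR_conv_of_real algebra_simps)
    define T where "T = t + a * u"
    have zT: "z = of_real T" using a by (simp add: T_def)
    have "\<bar>a * u\<bar> \<le> 1 * \<bar>u\<bar>" unfolding abs_mult using a by (intro mult_right_mono) auto
    then have Tt: "\<bar>T - t\<bar> \<le> \<bar>u\<bar>" by (simp add: T_def)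
    then have T2: "t / 2 \<le> T" using u by linarith
    then have T1: "1 \<le> T" using t by linarith
    show "(f has_field_derivative rs_theta_deriv z - of_real l) (at z within closed_segment (of_real t) (of_real (t + u)))"
      unfolding f_def using rs_theta_has_field_derivative[of z] zT
      by (auto intro!: derivative_eq_intros)
    have "rs_theta_deriv z - of_real l = (rs_theta_deriv (of_real T) - of_real (ln (T / (2 * pi)) / 2)) + of_real ((ln T - ln t) / 2)"
      using T1 t unfolding zT l_def by (simp add: ln_div field_simps)
    also have "norm \<dots> \<le> 7 / T + \<bar>u\<bar> / t"
    proof (intro order_trans[OF norm_triangle_ineq] add_mono rs_theta_deriv_real_approx T1)
      have "\<bar>ln T - ln t\<bar> \<le> \<bar>u\<bar> / (t / 2)"
      proof -
        have "ln T - ln t \<le> (T - t) / t"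
        proof -
          have "ln T - ln t = ln (T / t)" using T1 t by (simp add: ln_div)
          also have "\<dots> \<le> T / t - 1" using T1 t by (intro ln_le_minus_one) auto
          finally show ?thesis using t by (simp add: diff_divide_distrib)
        qed
        also have "\<dots> \<le> \<bar>u\<bar> / (t / 2)" using Tt t by (intro frac_le) auto
        finally have 1: "ln T - ln t \<le> \<bar>u\<bar> / (t / 2)" .
        have "ln t - ln T \<le> (t - T) / T"
        proof -
          have "ln t - ln T = ln (t / T)" using T1 t by (simp add: ln_div)
          also have "\<dots> \<le> t / T - 1" using T1 t by (intro ln_le_minus_one) auto
          finally show ?thesis using T1 by (simp add: diff_divide_distrib)
        qed
        also have "\<dots> \<le> \<bar>u\<bar> / (t / 2)" using Tt T2 t by (intro frac_le) auto
        finally show ?thesis using 1 by linarith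
      qed
      then show "norm (complex_of_real ((ln T - ln t) / 2)) \<le> \<bar>u\<bar> / t"
        unfolding norm_of_real by (simp add: field_simps)
    qed
    also have "7 / T \<le> 7 / (t / 2)" using T2 t by (intro divide_left_mono) auto
    also have "7 / (t / 2) + \<bar>u\<bar> / t \<le> 14 * (1 + \<bar>u\<bar>) / t" using t by (simp add: field_simps)
    finally show "norm (rs_theta_deriv z - of_real l) \<le> 14 * (1 + \<bar>u\<bar>) / t" by simp
  qed auto
  moreover have "f (of_real (t + u)) - f (of_real t) = rs_theta (of_real (t + u)) - rs_theta (of_real t) - of_real (u / 2 * ln (t / (2 * pi)))"
    by (simp add: f_def l_def algebra_simps)
  moreover have "14 * (1 + \<bar>u\<bar>) / t * norm (complex_of_real (t + u) - of_real t) = 14 * \<bar>u\<bar> * (1 + \<bar>u\<bar>) / t"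
    by (simp add: mult_ac)
  ultimately show ?thesis by (simp only:)
qed

text \<open>1/8 is the least real part of 1/4 + iz/2 and 1/4 - iz/2 for -1/4 <= Im z <= 0. The
  constant is 144 for the distance to Ln, 7 for a small modulus and 4 for the argument.\<close>

lemma norm_Digamma_strip:
  assumes w: "1/8 \<le> Re w" "norm w \<le> 1 + y" "0 \<le> y"
  shows "norm (Digamma w) \<le> 155 + ln (1 + y)"
proof -
  have n: "1/8 \<le> norm w" using w complex_Re_le_cmod[of w] by linarith
  have "norm (Digamma w - Ln w) \<le> 2 / (norm w)\<^sup>2 + 2 / norm w" using w by (intro Digamma_approx_Ln) auto
  also have "\<dots> \<le> 2 / (1/8)\<^sup>2 + 2 / (1/8)" using n by (intro add_mono frac_le power_mono) auto
  finally have 1: "norm (Digamma w - Ln w) \<le> 144" by (simp add: power2_eq_square)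
  have w0: "w \<noteq> 0" using n by auto
  have "norm (Ln w) \<le> \<bar>Re (Ln w)\<bar> + \<bar>Im (Ln w)\<bar>" by (rule cmod_le)
  moreover have "\<bar>Im (Ln w)\<bar> \<le> pi" using Im_Ln_le_pi[OF w0] mpi_less_Im_Ln[OF w0] by linarith
  moreover have "\<bar>Re (Ln w)\<bar> \<le> 7 + ln (1 + y)"
  proof -
    have "ln (norm w) \<le> ln (1 + y)" using w n w0 by (intro ln_mono) auto
    moreover have "0 \<le> ln (1 + y)" using w by simp
    moreover have "- 7 \<le> ln (norm w)"
    proof -
      have "ln (inverse (norm w)) \<le> inverse (norm w) - 1" using w0 by (intro ln_le_minus_one) auto
      also have "inverse (norm w) \<le> inverse (1/8)" using n by (intro le_imp_inverse_le) auto
      finally show ?thesis using w0 by (simp add: ln_inverse)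
    qed
    ultimately show ?thesis using w0 by (simp add: abs_if)
  qed
  ultimately have "norm (Ln w) \<le> 11 + ln (1 + y)" using pi_less_4 by linarith
  then show ?thesis using 1 norm_triangle_sub[of "Digamma w" "Ln w"] by linarith
qed

text \<open>Theta is real at \<open>T\<close> and at \<open>t\<close>, so the modulus depends only
  on how far theta moves while the argument descends by \<open>v\<close>. Its derivative grows only
  like a logarithm, hence polynomial growth, uniformly for all real \<open>T\<close>.\<close>

theorem norm_exp_rs_theta_le:
  assumes v: "0 \<le> v" "v \<le> 1/4"
  shows "norm (exp (\<i> * rs_theta (of_real T - \<i> * of_real v) - \<i> * rs_theta (of_real t))) \<le> exp 20 * (1 + \<bar>T\<bar>)"
proof -
  let ?z = "complex_of_real T - \<i> * of_real v"
  define L where "L = ln (1 + \<bar>T\<bar>)"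
  have L0: "0 \<le> L" by (simp add: L_def)
  have "norm (rs_theta ?z - rs_theta (of_real T)) \<le> (79 + L / 2) * norm (?z - of_real T)"
  proof (rule field_differentiable_bound[where S = "closed_segment (of_real T) ?z" and f' = rs_theta_deriv])
    fix z assume "z \<in> closed_segment (complex_of_real T) ?z"
    then obtain a where a: "0 \<le> a" "a \<le> 1" "z = of_real T - \<i> * of_real (a * v)"
      by (auto simp: in_segment scaleR_conv_of_real algebra_simps)
    define c where "c = a * v"
    have "a * v \<le> 1 * (1/4)" using a v by (intro mult_mono) auto
    then have c: "0 \<le> c" "c \<le> 1/4" "z = of_real T - \<i> * of_real c" using a v by (auto simp: c_def)
    show "(rs_theta has_field_derivative rs_theta_deriv z) (at z within closed_segment (complex_of_real T) ?z)"
      by (rule rs_theta_has_field_derivative) (use c in auto)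
    have 1: "norm (Digamma (1/4 + \<i> * z / 2)) \<le> 155 + L" unfolding L_def
    proof (rule norm_Digamma_strip)
      show "norm (1/4 + \<i> * z / 2) \<le> 1 + \<bar>T\<bar>"
        using cmod_le[of "1/4 + \<i> * z / 2"] c by simp
    qed (use c in auto)
    have 2: "norm (Digamma (1/4 - \<i> * z / 2)) \<le> 155 + L" unfolding L_def
    proof (rule norm_Digamma_strip)
      show "norm (1/4 - \<i> * z / 2) \<le> 1 + \<bar>T\<bar>"
        using cmod_le[of "1/4 - \<i> * z / 2"] c by simp
    qed (use c in auto)
    have 3: "norm (of_real (ln pi) / 2 :: complex) \<le> 3 / 2"
      using ln_le_minus_one[of pi] pi_less_4 pi_gt3 by (simp add: norm_divide ln_ge_zero)
    have "norm (rs_theta_deriv z) \<le> ((155 + L) + (155 + L)) / 4 + 3 / 2"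
      unfolding rs_theta_deriv_def
      using order_trans[OF norm_triangle_ineq add_mono[OF 1 2]] 3
      by (intro order_trans[OF norm_triangle_ineq4] add_mono) (auto simp: norm_divide)
    then show "norm (rs_theta_deriv z) \<le> 79 + L / 2" by (simp add: field_simps)
  qed auto
  also have "\<dots> = (79 + L / 2) * v" using v by (simp add: norm_mult)
  also have "\<dots> \<le> (79 + L / 2) * (1/4)" using v L0 by (intro mult_left_mono) auto
  finally have d: "norm (rs_theta ?z - rs_theta (of_real T)) \<le> 20 + L" using L0 by simp
  have "Re (\<i> * rs_theta ?z - \<i> * rs_theta (of_real t)) = - Im (rs_theta ?z - rs_theta (of_real T))"
    by (simp add: Im_rs_theta_real)
  also have "\<dots> \<le> 20 + L" using abs_Im_le_cmod[of "rs_theta ?z - rs_theta (of_real T)"] d by linarith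
  finally have "norm (exp (\<i> * rs_theta ?z - \<i> * rs_theta (of_real t))) \<le> exp (20 + L)"
    by (simp only: norm_exp_eq_Re exp_le_cancel_iff)
  then show ?thesis by (simp add: exp_add L_def)
qed

section \<open>Contour shifts and the error estimate\<close>

definition csch_kernel :: "complex \<Rightarrow> complex" where
  "csch_kernel x = of_real pi / (2 * sinh (of_real pi * x / 2))"

definition theta_factor :: "real \<Rightarrow> complex \<Rightarrow> complex" where
  "theta_factor t x = exp (\<i> * rs_theta (of_real t + x) - \<i> * rs_theta (of_real t))"

definition stirling_factor :: "real \<Rightarrow> complex \<Rightarrow> complex" where
  "stirling_factor t x = exp (\<i> * x / 2 * of_real (ln (t / (2 * pi))))"

definition zeta_shift :: "real \<Rightarrow> complex \<Rightarrow> complex" where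
  "zeta_shift t x = zeta (1/2 + \<i> * (of_real t + x))"

abbreviation hline :: "real \<Rightarrow> real \<Rightarrow> real \<Rightarrow> complex" where
  "hline b c \<equiv> linepath (- of_real b - \<i> * of_real c) (of_real b - \<i> * of_real c)"

section \<open>Size and holomorphy of the factors\<close>

lemma norm_sinh_ge: "\<bar>sinh (Re z)\<bar> \<le> norm (sinh (z::complex))"
proof -
  have "\<bar>norm (exp z) - norm (exp (- z))\<bar> \<le> norm (exp z - exp (- z))" by (rule norm_triangle_ineq3)
  then show ?thesis by (simp add: sinh_field_def norm_divide)
qed

text \<open>The zeros are the points 2ik, which explains the limit \<sigma> < 2. Off the imaginary
  axis the real part bounds sinh from below; on it sinh becomes a sine.\<close>

lemma sinh_half_pi_nonzero:
  assumes "\<bar>Im x\<bar> < 2" "x \<noteq> 0"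
  shows "sinh (of_real pi * x / 2) \<noteq> 0"
proof (cases "Re x = 0")
  case False
  have "sinh (Re (of_real pi * x / 2)) \<noteq> 0" using False by simp
  then show ?thesis using norm_sinh_ge[of "of_real pi * x / 2"] by auto
next
  case True
  then have x: "x = \<i> * of_real (Im x)" "Im x \<noteq> 0" using assms by (auto simp: complex_eq_iff)
  have "\<i> * (of_real pi * x / 2) = of_real (- (pi * Im x / 2))"
    by (subst x(1)) (simp add: field_simps)
  then have eq: "sinh (of_real pi * x / 2) = - \<i> * of_real (sin (- (pi * Im x / 2)))"
    by (simp only: sinh_conv_sin sin_of_real)
  have "sin (pi * Im x / 2) \<noteq> 0"
  proof (cases "Im x > 0")
    case True
    have "0 < sin (pi * Im x / 2)" using True assms by (intro sin_gt_zero) auto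
    then show ?thesis by simp
  next
    case False
    have "0 < sin (- (pi * Im x / 2))"
    proof (rule sin_gt_zero)
      show "0 < - (pi * Im x / 2)" using False x(2) by (simp add: mult_pos_neg)
      have "pi * (- Im x) < pi * 2" using assms by (intro mult_strict_left_mono) auto
      then show "- (pi * Im x / 2) < pi" by simp
    qed
    then show ?thesis by simp
  qed
  then show ?thesis unfolding eq by simp
qed

text \<open>The true rate of decay is pi/2. Keeping 3/2 leaves a spare exp(-|Re x| / 2) to absorb
  polynomial growth on the infinite line.\<close>

lemma norm_csch_kernel_le:
  assumes "1 \<le> \<bar>Re x\<bar>"
  shows "norm (csch_kernel x) \<le> 8 * exp (- (3/2 * \<bar>Re x\<bar>))"
proof -
  define y where "y = pi * \<bar>Re x\<bar> / 2"
  have "3 * \<bar>Re x\<bar> \<le> pi * \<bar>Re x\<bar>" using pi_gt3 by (intro mult_right_mono) auto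
  then have y: "3/2 * \<bar>Re x\<bar> \<le> y" "1 \<le> y" using assms unfolding y_def by linarith+
  have "sinh y \<ge> exp y / 4"
  proof -
    have "exp (- y) \<le> 1" using y by simp
    moreover have "2 \<le> exp y" using y exp_ge_add_one_self[of y] by linarith
    ultimately have le: "exp (- y) \<le> exp y / 2" by linarith
    have "exp y / 4 = (exp y - exp y / 2) / 2" by simp
    also have "\<dots> \<le> sinh y"
      unfolding sinh_field_def by (intro divide_right_mono diff_left_mono le) simp
    finally show ?thesis .
  qed
  moreover have "exp (3/2 * \<bar>Re x\<bar>) \<le> exp y" using y by simp
  moreover have "norm (sinh (of_real pi * x / 2)) \<ge> sinh y"
  proof -
    have "\<bar>sinh (Re (of_real pi * x / 2))\<bar> = sinh y"
      unfolding y_def by (simp add: sinh_real_abs[symmetric] abs_mult del: sinh_real_abs)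
    then show ?thesis using norm_sinh_ge[of "of_real pi * x / 2"] by simp
  qed
  ultimately have s: "exp (3/2 * \<bar>Re x\<bar>) / 4 \<le> norm (sinh (of_real pi * x / 2))" by linarith
  have "norm (csch_kernel x) = pi / (2 * norm (sinh (of_real pi * x / 2)))"
    by (simp add: csch_kernel_def norm_divide norm_mult)
  also have "\<dots> \<le> 4 / (2 * (exp (3/2 * \<bar>Re x\<bar>) / 4))"
    using s pi_less_4 by (intro frac_le) auto
  also have "\<dots> = 8 * exp (- (3/2 * \<bar>Re x\<bar>))"
    unfolding exp_minus by (simp only: divide_inverse inverse_mult_distrib inverse_inverse_eq) simp
  finally show ?thesis .
qed

text \<open>From sinh y >= y; this 1/|u| meets the factor |u| of
  \<open>norm_theta_minus_stirling_le\<close>.\<close>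

lemma norm_csch_kernel_real_le:
  assumes "u \<noteq> 0"
  shows "norm (csch_kernel (of_real u)) \<le> 1 / \<bar>u\<bar>"
proof -
  define y where "y = pi * \<bar>u\<bar> / 2"
  have y: "0 < y" using assms by (simp add: y_def)
  have "y \<le> sinh y"
    using real_le_x_sinh[of y] y by (simp add: sinh_field_def exp_minus)
  also have "sinh y = \<bar>sinh (Re (of_real pi * of_real u / 2))\<bar>"
    unfolding y_def by (simp add: sinh_real_abs[symmetric] abs_mult del: sinh_real_abs)
  also have "\<dots> \<le> norm (sinh (of_real pi * complex_of_real u / 2))" by (rule norm_sinh_ge)
  finally have s: "y \<le> norm (sinh (of_real pi * complex_of_real u / 2))" .
  have "norm (csch_kernel (of_real u)) = pi / (2 * norm (sinh (of_real pi * complex_of_real u / 2)))"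
    by (simp add: csch_kernel_def norm_divide norm_mult)
  also have "\<dots> \<le> pi / (2 * y)" using s y by (intro frac_le) auto
  also have "\<dots> = 1 / \<bar>u\<bar>" by (simp add: y_def)
  finally show ?thesis .
qed

lemma csch_kernel_holomorphic: "csch_kernel holomorphic_on {x. \<bar>Im x\<bar> < 2} - {0}"
  unfolding csch_kernel_def
  by (intro holomorphic_intros) (use sinh_half_pi_nonzero in \<open>auto simp: sinh_conv_sin intro!: holomorphic_intros\<close>)

lemma rs_theta_holomorphic: "rs_theta holomorphic_on {z. \<bar>Im z\<bar> < 1/2}"
  using rs_theta_has_field_derivative unfolding holomorphic_on_def field_differentiable_def by blast

lemma theta_factor_holomorphic: "theta_factor t holomorphic_on {x. \<bar>Im x\<bar> < 1/2}"
proof -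
  have "(rs_theta \<circ> (\<lambda>x. of_real t + x)) holomorphic_on {x. \<bar>Im x\<bar> < 1/2}"
    by (rule holomorphic_on_compose_gen[OF _ rs_theta_holomorphic]) (auto intro!: holomorphic_intros)
  then show ?thesis unfolding theta_factor_def o_def by (intro holomorphic_intros)
qed

lemma stirling_factor_holomorphic: "stirling_factor t holomorphic_on S"
  unfolding stirling_factor_def by (intro holomorphic_intros) auto

text \<open>Im x < 1/2 corresponds to Re s > 0, and the excluded point x = -t - i/2 to the pole s =
  1.\<close>

lemma zeta_shift_holomorphic:
  "zeta_shift t holomorphic_on {x. Im x < 1/2 \<and> (Re x \<noteq> - t \<or> Im x \<noteq> - 1/2)}"
proof -
  have "(zeta \<circ> (\<lambda>x. 1/2 + \<i> * (of_real t + x))) holomorphic_on {x. Im x < 1/2 \<and> (Re x \<noteq> - t \<or> Im x \<noteq> - 1/2)}"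
    by (rule holomorphic_on_compose_gen[OF _ zeta_holomorphic]) (auto intro!: holomorphic_intros simp: complex_eq_iff)
  then show ?thesis unfolding zeta_shift_def o_def .
qed

section \<open>Moving and truncating horizontal lines\<close>

lemma contour_integral_primitive_linepath:
  assumes "\<And>x. x \<in> S \<Longrightarrow> (g has_field_derivative f x) (at x within S)" "convex S" "p \<in> S" "q \<in> S"
  shows "(f has_contour_integral (g q - g p)) (linepath p q)"
proof -
  have "path_image (linepath p q) \<subseteq> S" using assms(2-4) by (simp add: closed_segment_subset)
  from contour_integral_primitive[OF assms(1) valid_path_linepath this] show ?thesis by simp
qed

text \<open>A primitive on the convex domain turns both integrals into differences of end point
  values. What remains are the two vertical sides, each of length |c - d|, so \<open>f\<close> has
  to be estimated only there.\<close>

lemma hline_shift_bound: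
  assumes hol: "f holomorphic_on S" and S: "convex S" "open S"
    and sub: "\<And>x. \<bar>Re x\<bar> = b \<Longrightarrow> - Im x \<in> closed_segment c d \<Longrightarrow> x \<in> S"
    and bd: "\<And>x. \<bar>Re x\<bar> = b \<Longrightarrow> - Im x \<in> closed_segment c d \<Longrightarrow> norm (f x) \<le> B"
    and b: "0 \<le> b"
  shows "norm (contour_integral (hline b c) f - contour_integral (hline b d) f) \<le> 2 * B * \<bar>c - d\<bar>"
proof -
  define p where "p = (\<lambda>r c. complex_of_real r - \<i> * of_real c)"
  obtain g where g: "\<And>x. x \<in> S \<Longrightarrow> (g has_field_derivative f x) (at x within S)"
    using holomorphic_convex_primitive'[OF S hol] by blast
  have pS: "p r e \<in> S" if "\<bar>r\<bar> = b" "e \<in> closed_segment c d" for r e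
    using that by (intro sub) (auto simp: p_def)
  have I: "(f has_contour_integral (g (p r' e') - g (p r e))) (linepath (p r e) (p r' e'))"
    if "\<bar>r\<bar> = b" "e \<in> closed_segment c d" "\<bar>r'\<bar> = b" "e' \<in> closed_segment c d" for r e r' e'
    by (rule contour_integral_primitive_linepath[OF g S(1)]) (use pS that in auto)
  have side: "norm (g (p r d) - g (p r c)) \<le> B * \<bar>c - d\<bar>" if r: "\<bar>r\<bar> = b" for r
  proof -
    have "norm (g (p r d) - g (p r c)) \<le> B * norm (p r d - p r c)"
    proof (rule has_contour_integral_bound_linepath[OF I])
      fix x assume "x \<in> closed_segment (p r c) (p r d)"
      then obtain a where a: "0 \<le> a" "a \<le> 1" "x = p r ((1 - a) * c + a * d)"
        by (auto simp: in_segment p_def scaleR_conv_of_real algebra_simps)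
      have "(1 - a) * c + a * d \<in> closed_segment c d" using a by (auto simp: in_segment)
      then show "norm (f x) \<le> B" unfolding a(3) using r by (intro bd) (auto simp: p_def add.commute)
    next
      have "norm (f (p r c)) \<le> B" using r by (intro bd) (auto simp: p_def)
      then show "0 \<le> B" using norm_ge_zero order_trans by blast
    qed (use r in auto)
    also have "norm (p r d - p r c) = \<bar>c - d\<bar>"
    proof -
      have "p r d - p r c = \<i> * of_real (c - d)" by (simp add: p_def algebra_simps)
      then show ?thesis by (simp only: norm_mult norm_ii norm_of_real) simp
    qed
    finally show ?thesis .
  qed
  have h: "hline b e = linepath (p (- b) e) (p b e)" for e by (simp add: p_def)
  have "contour_integral (hline b c) f = g (p b c) - g (p (- b) c)"
    "contour_integral (hline b d) f = g (p b d) - g (p (- b) d)"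
    unfolding h using b by (auto intro!: contour_integral_unique I)
  then have "contour_integral (hline b c) f - contour_integral (hline b d) f
      = (g (p (- b) d) - g (p (- b) c)) - (g (p b d) - g (p b c))" by simp
  also have "norm \<dots> \<le> B * \<bar>c - d\<bar> + B * \<bar>c - d\<bar>"
    using b by (intro order_trans[OF norm_triangle_ineq4 add_mono[OF side side]]) auto
  finally show ?thesis by simp
qed

lemma has_contour_integral_hline_iff:
  assumes "0 < b"
  shows "(f has_contour_integral I) (hline b c) \<longleftrightarrow> ((\<lambda>u. f (of_real u - \<i> * of_real c)) has_integral I) {- b..b}"
proof -
  let ?w = "\<i> * complex_of_real c"
  have "(f has_contour_integral I) (hline b c) \<longleftrightarrow>
      ((\<lambda>z. f (z - ?w)) has_contour_integral I) (linepath (of_real (- b)) (of_real b))"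
    unfolding has_contour_integral_linepath
    by (intro arg_cong[where f = "\<lambda>h. (h has_integral I) {0..1}"]) (simp add: linepath_def algebra_simps fun_eq_iff)
  also have "\<dots> \<longleftrightarrow> ((\<lambda>u. f (of_real u - ?w)) has_integral I) {- b..b}"
    using assms by (subst has_contour_integral_linepath_Reals_iff) auto
  finally show ?thesis .
qed

text \<open>An integral over \<open>UNIV\<close> has its intended value only for an integrable
  function, so domination has to yield integrability of the tails before it can bound them.\<close>

lemma norm_integral_tails_le:
  fixes g :: "real \<Rightarrow> complex"
  assumes cont: "continuous_on UNIV g" and b: "0 < b"
    and bd: "\<And>u. b \<le> \<bar>u\<bar> \<Longrightarrow> norm (g u) \<le> K * exp (- \<bar>u\<bar>)"
  shows "norm (integral UNIV g - integral {- b..b} g) \<le> 2 * K * exp (- b)"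
proof -
  have hr: "((\<lambda>u. exp (- u)) has_integral exp (- b)) {b..}"
    using has_integral_exp_minus_to_infinity[of 1 b] by simp
  then have ar: "(\<lambda>u. exp (- u)) absolutely_integrable_on {b..}"
    by (intro nonnegative_absolutely_integrable_1) auto
  have "(exp :: real \<Rightarrow> real) absolutely_integrable_on {..- b} \<and> integral {..- b} (exp :: real \<Rightarrow> real) = exp (- b)"
  proof (rule iffD1[OF has_absolute_integral_reflect_real[of "{b..}" "{..- b}" exp "exp (- b)"]])
    show "uminus ` {..- b} \<subseteq> {b..}" by auto
    show "(\<lambda>x. exp (- x)) absolutely_integrable_on {b..} \<and> integral {b..} (\<lambda>x. exp (- x)) = exp (- b)"
      using ar hr by (simp add: integral_unique)
  qed auto
  then have hl: "((exp :: real \<Rightarrow> real) has_integral exp (- b)) {..- b}"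
    using set_lebesgue_integral_eq_integral(1)[of "{..- b}" "exp :: real \<Rightarrow> real"]
    by (auto simp: has_integral_integral)
  have kr: "((\<lambda>u. K * exp (- u)) has_integral K * exp (- b)) {b..}" by (rule has_integral_mult_right[OF hr])
  have kl: "((\<lambda>u. K * exp u) has_integral K * exp (- b)) {..- b}" by (rule has_integral_mult_right[OF hl])
  have meas: "g \<in> borel_measurable (lebesgue_on S)" if "S \<in> sets lebesgue" for S
    using cont that by (intro continuous_imp_measurable_on_sets_lebesgue continuous_on_subset[OF cont]) auto
  have br: "norm (g u) \<le> K * exp (- u)" if "u \<in> {b..}" for u
    using bd[of u] that b by auto
  have bl: "norm (g u) \<le> K * exp u" if "u \<in> {..- b}" for u
    using bd[of u] that b by auto
  have ir: "g integrable_on {b..}"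
    by (rule measurable_bounded_by_integrable_imp_integrable[OF meas _ br]) (use kr in auto)
  have il: "g integrable_on {..- b}"
    by (rule measurable_bounded_by_integrable_imp_integrable[OF meas _ bl]) (use kl in auto)
  have im: "g integrable_on {- b..b}"
    by (intro integrable_continuous_interval continuous_on_subset[OF cont]) auto
  have U: "UNIV = ({..- b} \<union> {- b..b}) \<union> {b..}" using b by auto
  have n1: "negligible ({..- b} \<inter> {- b..b})"
    by (rule negligible_subset[of "{- b}"]) auto
  have n2: "negligible (({..- b} \<union> {- b..b}) \<inter> {b..})"
    by (rule negligible_subset[of "{b}"]) (use b in auto)
  have "integral UNIV g = integral {..- b} g + integral {- b..b} g + integral {b..} g"
    unfolding U using il im ir n1 n2 by (subst integral_Un) (auto intro!: integrable_Un)
  then have "norm (integral UNIV g - integral {- b..b} g) \<le> norm (integral {..- b} g) + norm (integral {b..} g)"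
    using norm_triangle_ineq by simp
  moreover have "norm (integral {b..} g) \<le> K * exp (- b)"
    using integral_norm_bound_integral[OF ir has_integral_integrable[OF kr] br] unfolding integral_unique[OF kr] .
  moreover have "norm (integral {..- b} g) \<le> K * exp (- b)"
    using integral_norm_bound_integral[OF il has_integral_integrable[OF kl] bl] unfolding integral_unique[OF kl] .
  ultimately show ?thesis by simp
qed

lemma norm_zeta_shift_le:
  assumes "7 \<le> t" "\<bar>Re x\<bar> \<le> t / 2" "Im x \<le> 0" "- 2 \<le> Im x"
  shows "norm (zeta_shift t x) \<le> 12 * t"
proof -
  let ?s = "1/2 + \<i> * (of_real t + x)"
  have "\<bar>Im (?s - 1)\<bar> \<le> norm (?s - 1)" by (rule abs_Im_le_cmod)
  then have "norm (zeta ?s) \<le> 5 + 2 * norm ?s" using assms by (intro norm_zeta_le) auto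
  moreover have "norm ?s \<le> \<bar>Re ?s\<bar> + \<bar>Im ?s\<bar>" by (rule cmod_le)
  then have "norm ?s \<le> 5/2 + 3/2 * t" using assms by simp
  ultimately show ?thesis using assms unfolding zeta_shift_def by linarith
qed

text \<open>The bound 7 exceeds 2 pi, so the logarithm is nonnegative and the factor is largest at
  depth 2, where it equals t / (2 pi).\<close>

lemma norm_stirling_factor_le:
  assumes "7 \<le> t" "Im x \<le> 0" "- 2 \<le> Im x"
  shows "norm (stirling_factor t x) \<le> t"
proof -
  define l where "l = ln (t / (2 * pi))"
  have "2 * pi \<le> 7" using pi_approx by simp
  then have t: "1 \<le> t / (2 * pi)" using assms by simp
  then have l: "0 \<le> l" by (simp add: l_def)
  have "norm (stirling_factor t x) = exp (- Im x / 2 * l)"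
    unfolding stirling_factor_def l_def[symmetric] norm_exp_eq_Re by simp
  also have "- Im x / 2 * l \<le> 1 * l" using l assms by (intro mult_right_mono) auto
  also have "exp (1 * l) = t / (2 * pi)" using t assms by (simp add: l_def)
  also have "\<dots> \<le> t / 1" using pi_gt3 assms by (intro divide_left_mono) auto
  finally show ?thesis by simp
qed

lemma norm_theta_factor_le:
  assumes "Im x \<le> 0" "- 1/4 \<le> Im x"
  shows "norm (theta_factor t x) \<le> exp 20 * (1 + \<bar>t + Re x\<bar>)"
proof -
  have eq: "of_real t + x = of_real (t + Re x) - \<i> * of_real (- Im x)" by (simp add: complex_eq_iff)
  show ?thesis
    unfolding theta_factor_def eq by (rule norm_exp_rs_theta_le) (use assms in auto)
qed

text \<open>For real \<open>u\<close> both phases are real, and z -> exp(iz) is 1-Lipschitz on the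
  reals.\<close>

lemma norm_theta_minus_stirling_le:
  assumes "2 \<le> t" "\<bar>u\<bar> \<le> t / 2"
  shows "norm (theta_factor t (of_real u) - stirling_factor t (of_real u)) \<le> 14 * \<bar>u\<bar> * (1 + \<bar>u\<bar>) / t"
proof -
  define a where "a = rs_theta (of_real (t + u)) - rs_theta (of_real t)"
  define c where "c = complex_of_real (u / 2 * ln (t / (2 * pi)))"
  have "Im a = 0" unfolding a_def by (simp only: minus_complex.sel Im_rs_theta_real)
  then have R: "a \<in> \<real>" "c \<in> \<real>" by (auto simp: complex_is_Real_iff c_def)
  have "norm (exp (\<i> * a) - exp (\<i> * c)) \<le> 1 * norm (a - c)"
  proof (rule field_differentiable_bound[where S = "\<real>" and f' = "\<lambda>z. \<i> * exp (\<i> * z)"])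
    show "((\<lambda>z. exp (\<i> * z)) has_field_derivative \<i> * exp (\<i> * z)) (at z within \<real>)" for z
      by (auto intro!: derivative_eq_intros)
    show "norm (\<i> * exp (\<i> * z)) \<le> 1" if "z \<in> \<real>" for z
      using that by (auto simp: norm_mult norm_exp_eq_Re elim!: Reals_cases)
  qed (use R convex_Reals in auto)
  also have "norm (a - c) \<le> 14 * \<bar>u\<bar> * (1 + \<bar>u\<bar>) / t"
    unfolding a_def c_def by (rule rs_theta_increment[OF assms])
  finally show ?thesis
    unfolding theta_factor_def stirling_factor_def a_def c_def
    by (simp add: right_diff_distrib mult_ac)
qed

section \<open>The difference of the two integrands\<close>

definition diff_integrand :: "real \<Rightarrow> complex \<Rightarrow> complex" where
  "diff_integrand t x = (theta_factor t x - stirling_factor t x) * zeta_shift t x * csch_kernel x"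

text \<open>Numerator and denominator both vanish at 0; dividing each by x makes the singularity
  removable. Height 1/3 stays inside the strip |Im x| < 1/2 and leaves room on both sides of the
  real axis.\<close>

lemma diff_integrand_extension:
  assumes "0 < t"
  obtains G where "G holomorphic_on box (Complex (- t) (- 1/3)) (Complex t (1/3))"
    "\<And>x. x \<noteq> 0 \<Longrightarrow> G x = diff_integrand t x"
proof -
  define S where "S = box (Complex (- t) (- 1/3)) (Complex t (1/3))"
  have op: "open S" unfolding S_def by (rule open_box)
  have memS: "x \<in> S \<longleftrightarrow> - t < Re x \<and> Re x < t \<and> - 1/3 < Im x \<and> Im x < 1/3" for x
    unfolding S_def by (auto simp: in_box_complex_iff)
  have z0: "0 \<in> interior S" using op assms by (simp add: interior_open memS)
  define E where "E = (\<lambda>x. theta_factor t x - stirling_factor t x)"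
  \<comment> \<open>Reciprocal of the kernel, with derivative 1 at 0; so H(x)/x, completed at 0, has
    no zero in \<open>S\<close>.\<close>
  define H where "H = (\<lambda>x. 2 * sinh (of_real pi * x / 2) / complex_of_real pi)"
  have "E holomorphic_on S"
    unfolding E_def
    by (intro holomorphic_on_diff stirling_factor_holomorphic holomorphic_on_subset[OF theta_factor_holomorphic])
       (auto simp: memS)
  note hE = pole_lemma[OF this z0]
  have "H holomorphic_on S" unfolding H_def sinh_conv_sin by (intro holomorphic_intros) auto
  note hH = pole_lemma[OF this z0]
  have "(H has_field_derivative 1) (at 0)"
    unfolding H_def by (auto intro!: derivative_eq_intros)
  then have dH: "deriv H 0 = 1" by (rule DERIV_imp_deriv)
  have H0: "H 0 = 0" by (simp add: H_def)
  have E0: "E 0 = 0" by (simp add: E_def theta_factor_def stirling_factor_def)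
  define G where "G = (\<lambda>x. (if x = 0 then deriv E 0 else (E x - E 0) / (x - 0)) * zeta_shift t x
      / (if x = 0 then deriv H 0 else (H x - H 0) / (x - 0)))"
  show ?thesis
  proof
    have "zeta_shift t holomorphic_on S"
      by (rule holomorphic_on_subset[OF zeta_shift_holomorphic]) (auto simp: memS)
    moreover have "(if x = 0 then deriv H 0 else (H x - H 0) / (x - 0)) \<noteq> 0" if "x \<in> S" for x
    proof (cases "x = 0")
      case True then show ?thesis by (simp add: dH)
    next
      case False
      have "\<bar>Im x\<bar> < 2" using that by (auto simp: memS)
      then show ?thesis using False sinh_half_pi_nonzero[of x] by (simp add: H0) (simp add: H_def)
    qed
    ultimately show "G holomorphic_on box (Complex (- t) (- 1/3)) (Complex t (1/3))"
      unfolding G_def S_def[symmetric] by (intro holomorphic_on_divide holomorphic_on_mult hE hH)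
    show "G x = diff_integrand t x" if "x \<noteq> 0" for x
      using that by (simp add: G_def H0 E0) (simp add: diff_integrand_def csch_kernel_def E_def H_def)
  qed
qed

lemma norm_diff_integrand_side_le:
  assumes "7 \<le> t" "\<bar>Re x\<bar> = b" "1 \<le> b" "b \<le> t / 2" "Im x \<le> 0" "- 1/4 \<le> Im x"
  shows "norm (diff_integrand t x) \<le> 96 * (2 * exp 20 + 1) * (t\<^sup>2 * exp (- b))"
proof -
  have "norm (theta_factor t x) \<le> exp 20 * (1 + \<bar>t + Re x\<bar>)" by (rule norm_theta_factor_le) (use assms in auto)
  also have "\<dots> \<le> exp 20 * (2 * t)" using assms by (intro mult_left_mono) auto
  finally have "norm (theta_factor t x - stirling_factor t x) \<le> exp 20 * (2 * t) + t"
    using norm_stirling_factor_le[of t x] assms by (intro order_trans[OF norm_triangle_ineq4 add_mono]) auto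
  moreover have "norm (zeta_shift t x) \<le> 12 * t" by (rule norm_zeta_shift_le) (use assms in auto)
  moreover have "norm (csch_kernel x) \<le> 8 * exp (- b)"
    using norm_csch_kernel_le[of x] assms by (intro order_trans[OF norm_csch_kernel_le]) auto
  ultimately have "norm (diff_integrand t x) \<le> (exp 20 * (2 * t) + t) * (12 * t) * (8 * exp (- b))"
    unfolding diff_integrand_def norm_mult using assms by (intro mult_mono) auto
  also have "\<dots> = 96 * (2 * exp 20 + 1) * (t\<^sup>2 * exp (- b))" by (simp add: power2_eq_square algebra_simps)
  finally show ?thesis .
qed

lemma norm_stirling_integrand_side_le:
  assumes "7 \<le> t" "\<bar>Re x\<bar> = b" "1 \<le> b" "b \<le> t / 2" "Im x \<le> 0" "- 2 \<le> Im x"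
  shows "norm (stirling_factor t x * zeta_shift t x * csch_kernel x) \<le> 96 * (t\<^sup>2 * exp (- b))"
proof -
  have "norm (stirling_factor t x * zeta_shift t x * csch_kernel x) \<le> t * (12 * t) * (8 * exp (- b))"
    unfolding norm_mult
    using assms norm_zeta_shift_le[of t x] norm_stirling_factor_le[of t x]
    by (intro mult_mono order_trans[OF norm_csch_kernel_le]) auto
  then show ?thesis by (simp add: power2_eq_square mult_ac)
qed

text \<open>Holds along the whole line, also near u = -t, where Re s = 3/4 keeps zeta away from its
  pole. The growth of theta factor and zeta is y^2, paid for by t^2 and by exp(|u|/2) out of the
  kernel's exp(-3|u|/2).\<close>

lemma norm_theta_integrand_le:
  assumes t: "1 \<le> t" and u: "1 \<le> \<bar>u\<bar>"
  defines "x \<equiv> complex_of_real u - \<i> * of_real (1/4)"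
  shows "norm (theta_factor t x * zeta_shift t x * csch_kernel x) \<le> 1792 * exp 20 * t\<^sup>2 * exp (- \<bar>u\<bar>)"
proof -
  define y where "y = 1 + \<bar>t + u\<bar>"
  have y: "1 \<le> y" by (simp add: y_def)
  have th: "norm (theta_factor t x) \<le> exp 20 * y"
    using norm_theta_factor_le[of x t] by (simp add: x_def y_def)
  have ze: "norm (zeta_shift t x) \<le> 7 * y"
  proof -
    let ?s = "1/2 + \<i> * (of_real t + x)"
    have s: "?s = Complex (3/4) (t + u)" by (simp add: x_def complex_eq_iff)
    have "\<bar>Re (?s - 1)\<bar> \<le> norm (?s - 1)" by (rule abs_Re_le_cmod)
    then have "norm (zeta ?s) \<le> 5 + 2 * norm ?s" unfolding s by (intro norm_zeta_le) auto
    moreover have "norm ?s \<le> y" using cmod_le[of ?s] unfolding s by (simp add: y_def)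
    ultimately show ?thesis using y unfolding zeta_shift_def by linarith
  qed
  have ke: "norm (csch_kernel x) \<le> 8 * exp (- (3/2 * \<bar>u\<bar>))"
    using norm_csch_kernel_le[of x] u by (simp add: x_def)
  have yy: "y\<^sup>2 \<le> 32 * t\<^sup>2 * exp (\<bar>u\<bar> / 2)"
  proof -
    have "y \<le> 1 + t + \<bar>u\<bar>" unfolding y_def using t by linarith
    also have "\<dots> \<le> (2 * t) * (1 + \<bar>u\<bar>)" using t mult_right_mono[of 1 t "\<bar>u\<bar>"] by (simp add: algebra_simps)
    finally have "y\<^sup>2 \<le> ((2 * t) * (1 + \<bar>u\<bar>))\<^sup>2" using y by (intro power_mono) auto
    also have "\<dots> = 4 * t\<^sup>2 * (1 + \<bar>u\<bar>)\<^sup>2" by (simp add: power_mult_distrib)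
    also have "(1 + \<bar>u\<bar>)\<^sup>2 \<le> 8 * exp (\<bar>u\<bar> / 2)"
    proof -
      have "1 + \<bar>u\<bar> / 2 + (\<bar>u\<bar> / 2)\<^sup>2 / 2 \<le> exp (\<bar>u\<bar> / 2)" by (rule exp_lower_Taylor_quadratic) simp
      then show ?thesis using abs_ge_zero[of u] by (simp add: power2_eq_square algebra_simps)
    qed
    finally show ?thesis by (simp add: mult_left_mono)
  qed
  have "norm (theta_factor t x * zeta_shift t x * csch_kernel x) \<le> (exp 20 * y) * (7 * y) * (8 * exp (- (3/2 * \<bar>u\<bar>)))"
    unfolding norm_mult using th ze ke y by (intro mult_mono) auto
  also have "\<dots> = 56 * exp 20 * exp (- (3/2 * \<bar>u\<bar>)) * y\<^sup>2" by (simp add: power2_eq_square mult_ac)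
  also have "\<dots> \<le> 56 * exp 20 * exp (- (3/2 * \<bar>u\<bar>)) * (32 * t\<^sup>2 * exp (\<bar>u\<bar> / 2))"
    using yy by (intro mult_left_mono) auto
  also have "\<dots> = 1792 * exp 20 * t\<^sup>2 * (exp (- (3/2 * \<bar>u\<bar>)) * exp (\<bar>u\<bar> / 2))" by (simp add: mult_ac)
  also have "exp (- (3/2 * \<bar>u\<bar>)) * exp (\<bar>u\<bar> / 2) = exp (- \<bar>u\<bar>)" by (simp flip: exp_add)
  finally show ?thesis .
qed

text \<open>Fully explicit, with the size of zeta left open as \<open>Zm\<close>, so that both error
  terms follow from one inequality. The hypothesis on t^4 * exp(-b) says that t^2 * exp(-b), the
  size of all sides and tails, is at most t^(-2).\<close>

theorem U_minus_trunc_integral_bound: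
  assumes t: "7 \<le> t" and b: "1 \<le> b" "b \<le> t / 2" and e: "t ^ 4 * exp (- b) \<le> 1"
    and \<sigma>: "0 < \<sigma>" "\<sigma> < 2"
    and Z: "\<And>u. \<bar>u\<bar> \<le> b \<Longrightarrow> norm (zeta (1/2 + \<i> * of_real (t + u))) \<le> Zm"
  shows "norm (U t - trunc_integral b \<sigma> t) \<le> 5000 * exp 20 / t\<^sup>2 + 28 * (1 + b)\<^sup>2 * Zm / t"
proof -
  define X where "X = t\<^sup>2 * exp (- b)"
  have X0: "0 \<le> X" by (simp add: X_def)
  have "t\<^sup>2 * X = t ^ 4 * exp (- b)" by (simp add: X_def power2_eq_square power4_eq_xxxx)
  then have X: "X \<le> 1 / t\<^sup>2" using e t by (simp add: field_simps)
  have e20: "1 \<le> exp (20::real)" by simp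
  define F1 where "F1 = (\<lambda>x. theta_factor t x * zeta_shift t x * csch_kernel x)"
  define F2 where "F2 = (\<lambda>x. stirling_factor t x * zeta_shift t x * csch_kernel x)"
  define g where "g = (\<lambda>u. F1 (of_real u - \<i> * of_real (1/4)))"
  obtain G where G: "G holomorphic_on box (Complex (- t) (- 1/3)) (Complex t (1/3))"
    "\<And>x. x \<noteq> 0 \<Longrightarrow> G x = diff_integrand t x"
    using diff_integrand_extension[of t] t by auto
  have ci_eq: "F1 x - F2 x = diff_integrand t x" for x
    by (simp add: F1_def F2_def diff_integrand_def algebra_simps)

  have U: "U t = 1 / (2 * pi * \<i>) * integral UNIV g"
    unfolding U_def U_line_def Let_def g_def F1_def theta_factor_def zeta_shift_def csch_kernel_def ..
  have T: "trunc_integral b \<sigma> t = 1 / (2 * pi * \<i>) * contour_integral (hline b \<sigma>) F2"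
    unfolding trunc_integral_def F2_def stirling_factor_def zeta_shift_def csch_kernel_def ..

  \<comment> \<open>The strip between the pole of the kernel at 0 and the level Im x = -1/2, where
    theta and the pole of zeta impose limits.\<close>
  define Q where "Q = {x. - 1/2 < Im x \<and> Im x < 0}"
  have F1h: "F1 holomorphic_on Q"
    unfolding F1_def
    by (intro holomorphic_on_mult holomorphic_on_subset[OF theta_factor_holomorphic]
          holomorphic_on_subset[OF zeta_shift_holomorphic] holomorphic_on_subset[OF csch_kernel_holomorphic])
       (auto simp: Q_def)
  have F2h: "F2 holomorphic_on Q"
    unfolding F2_def
    by (intro holomorphic_on_mult stirling_factor_holomorphic
          holomorphic_on_subset[OF zeta_shift_holomorphic] holomorphic_on_subset[OF csch_kernel_holomorphic])
       (auto simp: Q_def)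
  have img: "complex_of_real u - \<i> * of_real (1/4) \<in> Q" for u by (simp add: Q_def)
  have seg: "closed_segment (- of_real b - \<i> * of_real (1/4)) (of_real b - \<i> * of_real (1/4)) \<subseteq> Q"
  proof -
    have "Q = {x. Im x > - 1/2} \<inter> {x. Im x < 0}" by (auto simp: Q_def)
    then have "convex Q" by (simp only: convex_Int convex_halfspace_Im_gt convex_halfspace_Im_lt)
    then show ?thesis by (intro closed_segment_subset) (auto simp: Q_def)
  qed
  have gc: "continuous_on UNIV g"
    unfolding g_def
    by (intro continuous_on_compose2[OF holomorphic_on_imp_continuous_on[OF F1h]] continuous_intros)
       (use img in auto)
  have i1: "F1 contour_integrable_on hline b (1/4)" "F2 contour_integrable_on hline b (1/4)"
    by (intro contour_integrable_continuous_linepath continuous_on_subset[OF _ seg]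
        holomorphic_on_imp_continuous_on F1h F2h)+

  have tail: "norm (integral UNIV g - contour_integral (hline b (1/4)) F1) \<le> 3584 * exp 20 * X"
  proof -
    have "norm (integral UNIV g - integral {- b..b} g) \<le> 2 * (1792 * exp 20 * t\<^sup>2) * exp (- b)"
      using b t gc unfolding g_def F1_def
      by (intro norm_integral_tails_le norm_theta_integrand_le) auto
    moreover have "contour_integral (hline b (1/4)) F1 = integral {- b..b} g"
      using has_contour_integral_integral[OF i1(1)] b
      by (subst (asm) has_contour_integral_hline_iff) (auto simp: g_def integral_unique)
    ultimately show ?thesis by (simp add: X_def mult_ac)
  qed
  have shift2: "norm (contour_integral (hline b (1/4)) F2 - contour_integral (hline b \<sigma>) F2) \<le> 384 * X"
  proof -
    \<comment> \<open>Deep enough for every \<sigma> < 2, yet free of poles: those of the kernel at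
      0 and -2i and that of zeta at Re x = -t lie outside the open box.\<close>
    define S where "S = box (Complex (- t) (- 2)) (Complex t 0)"
    have F2S: "F2 holomorphic_on S"
      unfolding F2_def
      by (intro holomorphic_on_mult stirling_factor_holomorphic
            holomorphic_on_subset[OF zeta_shift_holomorphic] holomorphic_on_subset[OF csch_kernel_holomorphic])
         (auto simp: S_def in_box_complex_iff)
    have strip: "- 2 < Im x \<and> Im x < 0" if "- Im x \<in> closed_segment (1/4) \<sigma>" for x
      using that \<sigma> by (auto simp: closed_segment_eq_real_ivl split: if_splits)
    have "norm (contour_integral (hline b (1/4)) F2 - contour_integral (hline b \<sigma>) F2) \<le> 2 * (96 * X) * \<bar>1/4 - \<sigma>\<bar>"
    proof (rule hline_shift_bound[OF F2S])
      show "x \<in> S" if "\<bar>Re x\<bar> = b" "- Im x \<in> closed_segment (1/4) \<sigma>" for x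
        using strip[OF that(2)] that(1) b t by (auto simp: S_def in_box_complex_iff)
      show "norm (F2 x) \<le> 96 * X" if "\<bar>Re x\<bar> = b" "- Im x \<in> closed_segment (1/4) \<sigma>" for x
        unfolding F2_def X_def using strip[OF that(2)] that(1) b t
        by (intro norm_stirling_integrand_side_le) auto
    qed (use b in \<open>auto simp: S_def convex_box open_box\<close>)
    also have "\<dots> \<le> 2 * (96 * X) * 2" using \<sigma> X0 by (intro mult_left_mono) auto
    finally show ?thesis by simp
  qed
  have shiftG: "norm (contour_integral (hline b (1/4)) G - contour_integral (hline b 0) G) \<le> 48 * (2 * exp 20 + 1) * X"
  proof -
    have strip: "- 1/4 \<le> Im x \<and> Im x \<le> 0" if "- Im x \<in> closed_segment (1/4) 0" for x
      using that by (auto simp: closed_segment_eq_real_ivl)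
    have "norm (contour_integral (hline b (1/4)) G - contour_integral (hline b 0) G)
        \<le> 2 * (96 * (2 * exp 20 + 1) * X) * \<bar>1/4 - 0\<bar>"
    proof (rule hline_shift_bound[OF G(1)])
      show "x \<in> box (Complex (- t) (- 1/3)) (Complex t (1/3))"
        if "\<bar>Re x\<bar> = b" "- Im x \<in> closed_segment (1/4) 0" for x
        using strip[OF that(2)] that(1) b t by (auto simp: in_box_complex_iff)
      show "norm (G x) \<le> 96 * (2 * exp 20 + 1) * X"
        if "\<bar>Re x\<bar> = b" "- Im x \<in> closed_segment (1/4) 0" for x
      proof -
        have "x \<noteq> 0" using that b by auto
        then show ?thesis
          unfolding G(2)[OF \<open>x \<noteq> 0\<close>] X_def using strip[OF that(2)] that(1) b t
          by (intro norm_diff_integrand_side_le) auto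
      qed
    qed (use b in \<open>auto simp: convex_box open_box\<close>)
    also have "\<dots> = 48 * (2 * exp 20 + 1) * X" by simp
    finally show ?thesis .
  qed
  have Zm0: "0 \<le> Zm" using order_trans[OF norm_ge_zero Z[of 0]] b by simp
  have main: "norm (contour_integral (hline b 0) G) \<le> 28 * (1 + b)\<^sup>2 * Zm / t"
  proof -
    have "closed_segment (- of_real b - \<i> * of_real 0) (of_real b - \<i> * of_real 0)
        \<subseteq> box (Complex (- t) (- 1/3)) (Complex t (1/3))"
      by (intro closed_segment_subset convex_box) (use b t in \<open>auto simp: in_box_complex_iff\<close>)
    then have "G contour_integrable_on hline b 0"
      by (intro contour_integrable_continuous_linepath continuous_on_subset[OF holomorphic_on_imp_continuous_on[OF G(1)]])
    then have "((\<lambda>u. G (of_real u - \<i> * of_real 0)) has_integral contour_integral (hline b 0) G) {- b..b}"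
      using has_contour_integral_integral has_contour_integral_hline_iff[of b G _ 0] b by auto
    then have hi: "((\<lambda>u. G (of_real u)) has_integral contour_integral (hline b 0) G) (cbox (- b) b)" by simp
    have "norm (contour_integral (hline b 0) G) \<le> (14 * (1 + b) / t * Zm) * measure lborel (cbox (- b) b)"
    \<comment> \<open>\<open>G\<close> agrees with the explicit integrand off 0 only, and a single
      point does not affect the integral.\<close>
    proof (rule has_integral_bound_spike_finite[OF _ _ hi, where S = "{0}"])
      fix u :: real assume "u \<in> cbox (- b) b - {0}"
      then have u: "\<bar>u\<bar> \<le> b" "u \<noteq> 0" by auto
      have "norm (G (of_real u)) = norm (diff_integrand t (of_real u))" using u by (simp add: G(2))
      also have "\<dots> \<le> (14 * \<bar>u\<bar> * (1 + \<bar>u\<bar>) / t) * Zm * (1 / \<bar>u\<bar>)"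
        unfolding diff_integrand_def norm_mult
      proof (intro mult_mono)
        show "norm (theta_factor t (of_real u) - stirling_factor t (of_real u)) \<le> 14 * \<bar>u\<bar> * (1 + \<bar>u\<bar>) / t"
          using u b t by (intro norm_theta_minus_stirling_le) auto
        show "norm (zeta_shift t (of_real u)) \<le> Zm" using Z[OF u(1)] by (simp add: zeta_shift_def)
        show "norm (csch_kernel (of_real u)) \<le> 1 / \<bar>u\<bar>" by (rule norm_csch_kernel_real_le[OF u(2)])
      qed (use t Zm0 in auto)
      also have "\<dots> = 14 * (1 + \<bar>u\<bar>) / t * Zm" using u by simp
      also have "\<dots> \<le> 14 * (1 + b) / t * Zm"
        using u t Zm0 by (intro mult_right_mono divide_right_mono) auto
      finally show "norm (G (of_real u)) \<le> 14 * (1 + b) / t * Zm" .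
    qed (use b t Zm0 in auto)
    also have "measure lborel (cbox (- b) b) = 2 * b" using b by simp
    also have "(14 * (1 + b) / t * Zm) * (2 * b) \<le> (14 * (1 + b) / t * Zm) * (2 * (1 + b))"
      using b t Zm0 by (intro mult_left_mono) auto
    also have "\<dots> = 28 * (1 + b)\<^sup>2 * Zm / t"
      by (simp add: power2_eq_square mult_ac) (simp add: algebra_simps)
    finally show ?thesis .
  qed
  have diffG: "contour_integral (hline b (1/4)) F1 - contour_integral (hline b (1/4)) F2 = contour_integral (hline b (1/4)) G"
  proof -
    have "contour_integral (hline b (1/4)) F1 - contour_integral (hline b (1/4)) F2
        = contour_integral (hline b (1/4)) (\<lambda>x. F1 x - F2 x)"
      by (rule contour_integral_diff[OF i1, symmetric])
    also have "\<dots> = contour_integral (hline b (1/4)) G"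
    proof (rule contour_integral_eq)
      fix x assume "x \<in> path_image (hline b (1/4))"
      then have "x \<in> Q" using seg by auto
      then have "x \<noteq> 0" by (auto simp: Q_def)
      then show "F1 x - F2 x = G x" using ci_eq[of x] by (simp add: G(2))
    qed
    finally show ?thesis .
  qed
  define D where "D = integral UNIV g - contour_integral (hline b \<sigma>) F2"
  \<comment> \<open>Full line to segment, depth \<sigma> to 1/4, then F1 - F2 = G from depth 1/4 to
    the real axis; only the last integral lacks the factor exp(-b) in its bound.\<close>
  have "D = (integral UNIV g - contour_integral (hline b (1/4)) F1)
      + ((contour_integral (hline b (1/4)) F2 - contour_integral (hline b \<sigma>) F2)
      + ((contour_integral (hline b (1/4)) G - contour_integral (hline b 0) G) + contour_integral (hline b 0) G))"
    unfolding D_def using diffG by (simp add: algebra_simps)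
  also have "norm \<dots> \<le> 3584 * exp 20 * X + (384 * X + (48 * (2 * exp 20 + 1) * X + 28 * (1 + b)\<^sup>2 * Zm / t))"
    by (intro order_trans[OF norm_triangle_ineq] add_mono tail shift2 shiftG main)
  also have "\<dots> \<le> 5000 * exp 20 / t\<^sup>2 + 28 * (1 + b)\<^sup>2 * Zm / t"
  proof -
    have "X \<le> exp 20 * X" using mult_right_mono[OF e20 X0] by simp
    moreover have "3584 * exp 20 * X + (384 * X + 48 * (2 * exp 20 + 1) * X) = 3680 * (exp 20 * X) + 432 * X"
      by (simp add: algebra_simps)
    ultimately have "3584 * exp 20 * X + (384 * X + 48 * (2 * exp 20 + 1) * X) \<le> 5000 * (exp 20 * X)"
      using X0 by linarith
    also have "\<dots> \<le> 5000 * (exp 20 * (1 / t\<^sup>2))" using X by (intro mult_left_mono) auto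
    finally show ?thesis by simp
  qed
  finally have D: "norm D \<le> 5000 * exp 20 / t\<^sup>2 + 28 * (1 + b)\<^sup>2 * Zm / t" .
  have "U t - trunc_integral b \<sigma> t = 1 / (2 * pi * \<i>) * D"
    unfolding U T D_def by (simp only: right_diff_distrib)
  then have "norm (U t - trunc_integral b \<sigma> t) = norm D / (2 * pi)"
    by (simp add: norm_mult norm_divide)
  also have "\<dots> \<le> norm D / 1" using pi_gt3 by (intro divide_left_mono) auto
  finally show ?thesis using D by simp
qed

text \<open>As b = C ln t is eventually at most t/2, all heights t + u occurring on the critical
  line lie in [t/2, 2t], so a bound for zeta there is enough.\<close>

lemma U_minus_trunc_integral_bigo:
  fixes Zm :: "real \<Rightarrow> real"
  assumes \<sigma>: "0 < \<sigma>" "\<sigma> < 2" and C: "4 \<le> C"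
    and Z: "eventually (\<lambda>t. \<forall>T. t / 2 \<le> T \<and> T \<le> 2 * t \<longrightarrow> norm (zeta (1/2 + \<i> * of_real T)) \<le> Zm t) at_top"
    and O: "(\<lambda>t. 5000 * exp 20 / t\<^sup>2 + 28 * (1 + C * ln t)\<^sup>2 * Zm t / t) \<in> O(\<lambda>t. t powr p)"
  shows "(\<lambda>t. U t - trunc_integral (C * ln t) \<sigma> t) \<in> O[at_top](\<lambda>t. of_real (t powr p))"
proof -
  from O obtain c where "c > 0"
    and c: "eventually (\<lambda>t. norm (5000 * exp 20 / t\<^sup>2 + 28 * (1 + C * ln t)\<^sup>2 * Zm t / t) \<le> c * norm (t powr p)) at_top"
    by (elim landau_o.bigE)
  have "eventually (\<lambda>t. C * ln t \<le> t / 2) at_top" using C by real_asymp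
  then have "eventually (\<lambda>t. norm (U t - trunc_integral (C * ln t) \<sigma> t)
      \<le> c * norm (complex_of_real (t powr p))) at_top"
    using c Z eventually_ge_at_top[of 7]
  proof eventually_elim
    case (elim t)
    have "exp 1 \<le> t" using exp_le elim by linarith
    then have "1 \<le> ln t" using elim by (simp add: ln_ge_iff)
    then have "4 * 1 \<le> C * ln t" using C by (intro mult_mono) auto
    \<comment> \<open>The origin of the threshold 4 for C: exp(-C ln t) <= t^(-4) makes the sides
      and tails O(t^(-2)).\<close>
    moreover have "t ^ 4 * exp (- (C * ln t)) \<le> 1"
    proof -
      have "exp (- (C * ln t)) \<le> exp (- (4 * ln t))"
        using C \<open>1 \<le> ln t\<close> by (simp add: mult_right_mono)
      also have "\<dots> = inverse (t ^ 4)"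
        using exp_of_nat_mult[of 4 "ln t"] elim by (simp add: exp_minus)
      finally show ?thesis using elim by (simp add: field_simps)
    qed
    ultimately have "norm (U t - trunc_integral (C * ln t) \<sigma> t)
        \<le> 5000 * exp 20 / t\<^sup>2 + 28 * (1 + C * ln t)\<^sup>2 * Zm t / t"
    proof (intro U_minus_trunc_integral_bound)
      fix u assume u: "\<bar>u\<bar> \<le> C * ln t"
      have "t / 2 \<le> t + u \<and> t + u \<le> 2 * t" using u elim(1,4) by linarith
      then show "norm (zeta (1/2 + \<i> * of_real (t + u))) \<le> Zm t" using elim(3) by blast
    qed (use elim \<sigma> in auto)
    also have "\<dots> \<le> c * norm (complex_of_real (t powr p))" using elim by simp
    finally show ?case .
  qed
  then show ?thesis by (rule landau_o.bigI[OF \<open>c > 0\<close>])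
qed

theorem mainTheorem5:
  fixes \<epsilon> \<sigma> :: real
  assumes "0 < \<epsilon>" "\<epsilon> < 1" "0 < \<sigma>" "\<sigma> < 2"
  shows "\<exists>C0>0. \<forall>C\<ge>C0.
     (\<lambda>t. U t - trunc_integral (C * ln t) \<sigma> t)
        \<in> O[at_top](\<lambda>t. of_real (t powr (- 5/6 + \<epsilon>))) \<and>
     (lindelof_hypothesis \<longrightarrow>
      (\<lambda>t. U t - trunc_integral (C * ln t) \<sigma> t)
        \<in> O[at_top](\<lambda>t. of_real (t powr (- 1 + \<epsilon>))))"
proof (intro exI[of _ 4] conjI allI impI)
  fix C :: real assume C: "4 \<le> C"
  show "(\<lambda>t. U t - trunc_integral (C * ln t) \<sigma> t) \<in> O[at_top](\<lambda>t. of_real (t powr (- 5/6 + \<epsilon>)))"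
  \<comment> \<open>Weyl's bound increases with the height, so it is taken at 2t. The error is then
    of order t^(-5/6) (ln t)^3, and t^\<epsilon> absorbs the logarithms.\<close>
  proof (rule U_minus_trunc_integral_bigo[where Zm = "\<lambda>t. 400 * (2 * t) powr (1/6) * (1 + ln (2 * t))"])
    show "eventually (\<lambda>t. \<forall>T. t / 2 \<le> T \<and> T \<le> 2 * t \<longrightarrow>
        norm (zeta (1/2 + \<i> * of_real T)) \<le> 400 * (2 * t) powr (1/6) * (1 + ln (2 * t))) at_top"
      using eventually_ge_at_top[of 2]
    proof (eventually_elim, intro allI impI)
      fix t T :: real assume t: "2 \<le> t" and T: "t / 2 \<le> T \<and> T \<le> 2 * t"
      have "norm (zeta (1/2 + \<i> * of_real T)) \<le> 400 * T powr (1/6) * (1 + ln T)"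
        using t T by (intro zeta_weyl_bound) auto
      also have "\<dots> \<le> 400 * (2 * t) powr (1/6) * (1 + ln (2 * t))"
        using t T by (intro mult_mono add_mono powr_mono2) auto
      finally show "norm (zeta (1/2 + \<i> * of_real T)) \<le> 400 * (2 * t) powr (1/6) * (1 + ln (2 * t))" .
    qed
    show "(\<lambda>t. 5000 * exp 20 / t\<^sup>2 + 28 * (1 + C * ln t)\<^sup>2 * (400 * (2 * t) powr (1/6) * (1 + ln (2 * t))) / t)
        \<in> O(\<lambda>t. t powr (- 5/6 + \<epsilon>))"
      using assms(1,2) C by real_asymp
  qed (use assms C in auto)
next
  fix C :: real assume C: "4 \<le> C" and L: "lindelof_hypothesis"
  \<comment> \<open>Using \<epsilon>/2 keeps a factor t^(\<epsilon>/2) in reserve for (ln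
    t)^2.\<close>
  have "(\<lambda>t::real. zeta (1/2 + \<i> * of_real t)) \<in> O[at_infinity](\<lambda>t. of_real (\<bar>t\<bar> powr (\<epsilon> / 2)))"
    using L assms unfolding lindelof_hypothesis_def by simp
  then obtain c where c: "c > 0"
    "eventually (\<lambda>t::real. norm (zeta (1/2 + \<i> * of_real t)) \<le> c * norm (complex_of_real (\<bar>t\<bar> powr (\<epsilon> / 2)))) at_infinity"
    by (elim landau_o.bigE)
  then obtain T0 where T0: "\<And>T::real. T0 \<le> norm T \<Longrightarrow> norm (zeta (1/2 + \<i> * of_real T)) \<le> c * (\<bar>T\<bar> powr (\<epsilon> / 2))"
    unfolding eventually_at_infinity by auto
  show "(\<lambda>t. U t - trunc_integral (C * ln t) \<sigma> t) \<in> O[at_top](\<lambda>t. of_real (t powr (- 1 + \<epsilon>)))"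
  proof (rule U_minus_trunc_integral_bigo[where Zm = "\<lambda>t. c * (2 * t) powr (\<epsilon> / 2)"])
    show "eventually (\<lambda>t. \<forall>T. t / 2 \<le> T \<and> T \<le> 2 * t \<longrightarrow>
        norm (zeta (1/2 + \<i> * of_real T)) \<le> c * (2 * t) powr (\<epsilon> / 2)) at_top"
      using eventually_ge_at_top[of "max 2 (2 * T0)"]
    proof (eventually_elim, intro allI impI)
      fix t T :: real assume t: "max 2 (2 * T0) \<le> t" and T: "t / 2 \<le> T \<and> T \<le> 2 * t"
      have "norm (zeta (1/2 + \<i> * of_real T)) \<le> c * (\<bar>T\<bar> powr (\<epsilon> / 2))"
        using t T by (intro T0) auto
      also have "\<dots> \<le> c * (2 * t) powr (\<epsilon> / 2)"
        using t T c(1) assms by (intro mult_left_mono powr_mono2) auto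
      finally show "norm (zeta (1/2 + \<i> * of_real T)) \<le> c * (2 * t) powr (\<epsilon> / 2)" .
    qed
    show "(\<lambda>t. 5000 * exp 20 / t\<^sup>2 + 28 * (1 + C * ln t)\<^sup>2 * (c * (2 * t) powr (\<epsilon> / 2)) / t)
        \<in> O(\<lambda>t. t powr (- 1 + \<epsilon>))"
      using assms(1,2) C c(1) by real_asymp
  qed (use assms C in auto)
qed simp

end
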